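(* Let $\sigma>1/\sqrt2$, $\tau\in\mathbb{R}$ with $\tau\neq0$, and $|\rho|<1$; put $\beta=(\sigma,\tau)$. Then, as $N\to\infty$, $$\frac{\mathcal{Z}_N(\beta)-N\,\mathbb{E}\big[e^{\sqrt n(\sigma X+i\tau Y)}\mathbf{1}_{X<b_N}\big]}{e^{\sigma\sqrt n\,b_N}}\;\longrightarrow\;S_{\sqrt2/\sigma}\qquad\text{in distribution,}$$ where $S_\alpha$ denotes a complex isotropic $\alpha$-stable random variable, with characteristic function of the form $\mathbb{E}\big[e^{i\,\mathrm{Re}(S_\alpha\overline z)}\big]=e^{-c|z|^\alpha}$, $z\in\mathbb{C}$, for some constant $c>0$.
   Context: Let $(X,Y),(X_1,Y_1),(X_2,Y_2),\ldots$ be i.i.d. zero-mean bivariate real Gaussian vectors with unit variances and correlation $\mathrm{Corr}(X_k,Y_k)=\rho$. For $N\in\mathbb{N}$ put $n=\log N$ (natural logarithm) and $\mathcal{Z}_N(\beta)=\sum_{k=1}^N e^{\sqrt n(\sigma X_k+i\tau Y_k)}$. The sequence $b_N$ satisfies $\sqrt{2\pi}\,b_N e^{b_N^2/2}\sim N$ as $N\to\infty$; one can take $b_N=\sqrt{2n}-\frac{\log(4\pi n)}{2\sqrt{2n}}$. *)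

theory Defs
  imports "HOL-Probability.Probability" "HOL-Library.Landau_Symbols"
begin

text \<open>Lebesgue density of the centred bivariate Gaussian law with unit variances and
  correlation \<open>\<rho>\<close>, where \<open>\<bar>\<rho>\<bar> < 1\<close>.\<close>

definition bivariate_normal_density :: "real \<Rightarrow> real \<times> real \<Rightarrow> real" where
  "bivariate_normal_density \<rho> = (\<lambda>(x, y).
     1 / (2 * pi * sqrt (1 - \<rho>\<^sup>2)) *
     exp (- (x\<^sup>2 - 2 * \<rho> * x * y + y\<^sup>2) / (2 * (1 - \<rho>\<^sup>2))))"

text \<open>The pair with index \<open>0\<close> plays the role of the generic vector \<open>(X, Y)\<close>; the pairs
  with indices \<open>k \<ge> 1\<close> form the sequence \<open>(X\<^sub>k, Y\<^sub>k)\<close>.\<close>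

definition iid_gaussian_pairs ::
  "'a measure \<Rightarrow> real \<Rightarrow> (nat \<Rightarrow> 'a \<Rightarrow> real) \<Rightarrow> (nat \<Rightarrow> 'a \<Rightarrow> real) \<Rightarrow> bool" where
  "iid_gaussian_pairs M \<rho> X Y \<longleftrightarrow>
     prob_space M \<and>
     prob_space.indep_vars M (\<lambda>_. borel) (\<lambda>k \<omega>. (X k \<omega>, Y k \<omega>)) UNIV \<and>
     (\<forall>k. distributed M lborel (\<lambda>\<omega>. (X k \<omega>, Y k \<omega>))
            (\<lambda>p. ennreal (bivariate_normal_density \<rho> p)))"

definition partition_function ::
  "(nat \<Rightarrow> 'a \<Rightarrow> real) \<Rightarrow> (nat \<Rightarrow> 'a \<Rightarrow> real) \<Rightarrow> real \<times> real \<Rightarrow> nat \<Rightarrow> 'a \<Rightarrow> complex" where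
  "partition_function X Y = (\<lambda>(\<sigma>, \<tau>) N \<omega>.
     \<Sum>k=1..N. exp (complex_of_real (sqrt (ln (real N))) *
       (complex_of_real (\<sigma> * X k \<omega>) + \<i> * complex_of_real (\<tau> * Y k \<omega>))))"

definition truncated_mean ::
  "'a measure \<Rightarrow> ('a \<Rightarrow> real) \<Rightarrow> ('a \<Rightarrow> real) \<Rightarrow> real \<times> real \<Rightarrow> (nat \<Rightarrow> real) \<Rightarrow> nat \<Rightarrow> complex" where
  "truncated_mean M X Y = (\<lambda>(\<sigma>, \<tau>) b N.
     (\<integral>\<omega>. exp (complex_of_real (sqrt (ln (real N))) *
       (complex_of_real (\<sigma> * X \<omega>) + \<i> * complex_of_real (\<tau> * Y \<omega>)))
       * indicator {..<b N} (X \<omega>) \<partial>M))"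

text \<open>The limit is given by its law \<open>S\<close>. The library's \<^const>\<open>weak_conv_m\<close> covers laws
  on the real line only.\<close>

definition converges_in_distribution ::
  "'a measure \<Rightarrow> (nat \<Rightarrow> 'a \<Rightarrow> 'b::topological_space) \<Rightarrow> 'b measure \<Rightarrow> bool" where
  "converges_in_distribution M Z S \<longleftrightarrow>
     (\<forall>f :: 'b \<Rightarrow> real. continuous_on UNIV f \<and> bounded (range f) \<longrightarrow>
        (\<lambda>N. \<integral>\<omega>. f (Z N \<omega>) \<partial>M) \<longlonglongrightarrow> (\<integral>w. f w \<partial>S))"

text \<open>With \<open>w\<close> distributed according to \<open>S\<close>, the characteristic function is taken at
  \<open>z \<in> \<complex>\<close> with respect to the pairing \<open>Re (w * cnj z)\<close>; the scale \<open>c\<close> is not fixed.\<close>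

definition isotropic_stable_law :: "real \<Rightarrow> complex measure \<Rightarrow> bool" where
  "isotropic_stable_law \<alpha> S \<longleftrightarrow>
     prob_space S \<and> sets S = sets borel \<and>
     (\<exists>c>0. \<forall>z. (\<integral>w. iexp (Re (w * cnj z)) \<partial>S) =
                  complex_of_real (exp (- c * cmod z powr \<alpha>)))"

end

theory Submission imports Defs "HOL-Real_Asymp.Real_Asymp" begin

text \<open>
  Write \<open>\<alpha> = sqrt 2 / \<sigma>\<close>, which lies in \<open>(0, 2)\<close>, and \<open>s = sqrt (ln N)\<close>. After normalisation one summand is
  \<open>W = exp (\<sigma> s (X - b\<^sub>N)) * iexp (\<tau> s Y)\<close>. Its modulus is governed by the position of \<open>X\<close> near the
  level \<open>b\<^sub>N\<close>: by the choice of \<open>b\<^sub>N\<close> the measure \<open>N P(s (X - b\<^sub>N) \<in> dy)\<close> tends to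
  \<open>sqrt 2 exp (- sqrt 2 y) dy\<close>, the intensity of the extremes of a Gaussian sample, so the modulus
  \<open>exp (\<sigma> y)\<close> has a tail of index \<open>\<alpha>\<close>. Its argument \<open>\<tau> s Y\<close> has, conditionally on \<open>X\<close>, a Gaussian law with
  variance \<open>\<tau>\<^sup>2 (1 - \<rho>\<^sup>2) ln N\<close>, which tends to infinity; modulo \<open>2 pi\<close> it becomes uniform, whatever \<open>\<tau> \<noteq> 0\<close>
  and \<open>\<bar>\<rho>\<bar> < 1\<close> are. Hence the limit is isotropic and depends on \<open>\<sigma>\<close> alone.

  The proof turns this into characteristic functions. By independence that of the centred sum is the
  \<open>N\<close>-th power of the one of a single centred summand, so it is enough that \<open>N (E iexp (Re ((W - m) cnj z)) - 1)\<close>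
  tends to \<open>- c \<bar>z\<bar> powr \<alpha>\<close>, where \<open>m\<close> is the mean of \<open>W\<close> truncated to \<open>X < b\<^sub>N\<close> (\<open>power_tendsto_exp\<close>). Averaging
  over the phase replaces \<open>iexp (Re (W cnj z))\<close> by \<open>circle_mean \<bar>W z\<bar>\<close>, the Bessel function of order zero, and
  dominated convergence in the variable \<open>y\<close> gives the integral
  \<open>\<integral> sqrt 2 exp (- sqrt 2 y) (circle_mean (\<bar>z\<bar> exp (\<sigma> y)) - 1) dy\<close> (\<open>N_excess_tendsto\<close>), which is homogeneous of degree
  \<open>\<alpha>\<close> in \<open>\<bar>z\<bar>\<close> (\<open>stable_scale_homogeneous\<close>). It is \<open>\<sigma> > 1 / sqrt 2\<close> that makes it converge at \<open>- \<infinity>\<close>. The centring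
  does no more than cancel the linear Taylor term of the small summands: \<open>N \<bar>m\<bar>\<^sup>2\<close> tends to zero, since the averaged
  phase is at most a negative power of \<open>N\<close> and \<open>N E (\<bar>W\<bar>\<^sup>2; X < b\<^sub>N)\<close> stays bounded (\<open>N_truncated_mean_sq_tendsto\<close>).

  Two general facts carry the conclusion over to laws. Pointwise convergence of characteristic functions on \<open>\<complex>\<close>
  to that of a probability measure implies convergence in distribution (\<open>complex_levy_continuity\<close>), by
  approximating test functions with trigonometric polynomials. And there is a probability measure with
  characteristic function \<open>exp (- c \<bar>z\<bar> powr \<alpha>)\<close> (\<open>isotropic_stable_law_exists\<close>): a planar Gaussian whose variance is an
  independent positive \<open>\<alpha> / 2\<close>-stable variable, the latter being a weak limit of scaled sums of Sibuya
  variables.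
\<close>

abbreviation gauss :: "real measure" where "gauss \<equiv> std_normal_distribution"

section \<open>Trigonometric polynomials and Levy continuity in the complex plane\<close>

text \<open>The closure under addition alone already gives an algebra, since a product of two waves is a sum of two waves.
  Complex coefficients provide the sines along with the cosines.\<close>

inductive_set trig_polys :: "(complex \<Rightarrow> real) set" where
  wave: "(\<lambda>w. Re (c * iexp (Re (w * cnj z)))) \<in> trig_polys"
| add: "f \<in> trig_polys \<Longrightarrow> g \<in> trig_polys \<Longrightarrow> (\<lambda>w. f w + g w) \<in> trig_polys"

lemma Re_mult_Re: "Re a * Re b = Re (a * b / 2) + Re (a * cnj b / 2)"
  by (simp add: field_simps)

lemma trig_polys_const: "(\<lambda>_. a) \<in> trig_polys"
  using trig_polys.wave[of "of_real a" 0] by simp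

lemma trig_polys_wave_mult:
  assumes "g \<in> trig_polys"
  shows "(\<lambda>w. Re (c * iexp (Re (w * cnj z))) * g w) \<in> trig_polys"
  using assms
proof (induction rule: trig_polys.induct)
  case (wave d y)
  have "Re (c * iexp (Re (w * cnj z))) * Re (d * iexp (Re (w * cnj y))) =
        Re (c * d / 2 * iexp (Re (w * cnj (z + y)))) + Re (c * cnj d / 2 * iexp (Re (w * cnj (z - y))))" for w
  proof -
    have sum: "iexp (Re (w * cnj (z + y))) = iexp (Re (w * cnj z)) * iexp (Re (w * cnj y))"
      by (simp add: exp_add[symmetric] ring_distribs)
    have diff: "iexp (Re (w * cnj (z - y))) = iexp (Re (w * cnj z)) * cnj (iexp (Re (w * cnj y)))"
      by (simp add: exp_add[symmetric] exp_cnj algebra_simps)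
    show ?thesis
      unfolding sum diff Re_mult_Re[of "c * iexp (Re (w * cnj z))"] complex_cnj_mult
      by (simp only: ac_simps times_divide_eq_left times_divide_eq_right)
  qed
  then show ?case
    by (simp only:) (intro trig_polys.intros)
next
  case (add f g)
  then show ?case
    by (simp only: distrib_left) (intro trig_polys.intros)
qed

lemma trig_polys_mult:
  assumes "f \<in> trig_polys" "g \<in> trig_polys"
  shows "(\<lambda>w. f w * g w) \<in> trig_polys"
  using assms(1)
proof (induction rule: trig_polys.induct)
  case (wave c z)
  show ?case by (rule trig_polys_wave_mult[OF assms(2)])
next
  case (add f h)
  then show ?case
    by (simp only: distrib_right) (intro trig_polys.intros)
qed

lemma trig_polys_continuous: "f \<in> trig_polys \<Longrightarrow> continuous_on S f"
  by (induction rule: trig_polys.induct) (intro continuous_intros | simp)+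

lemma trig_polys_bounded: "f \<in> trig_polys \<Longrightarrow> \<exists>B. \<forall>w. \<bar>f w\<bar> \<le> B"
proof (induction rule: trig_polys.induct)
  case (wave c z)
  have "\<bar>Re (c * iexp (Re (w * cnj z)))\<bar> \<le> cmod c" for w
    using abs_Re_le_cmod[of "c * iexp (Re (w * cnj z))"] by (simp add: norm_mult)
  then show ?case by blast
next
  case (add f g)
  then obtain B C where "\<forall>w. \<bar>f w\<bar> \<le> B" "\<forall>w. \<bar>g w\<bar> \<le> C" by blast
  then have "\<forall>w. \<bar>f w + g w\<bar> \<le> B + C"
    by (meson abs_triangle_ineq add_mono order_trans)
  then show ?case by blast
qed

lemma trig_polys_real_polynomial:
  assumes "real_polynomial_function (p :: real \<Rightarrow> real)" "g \<in> trig_polys"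
  shows "(\<lambda>w. p (g w)) \<in> trig_polys"
  using assms(1)
proof (induction rule: real_polynomial_function.induct)
  case (linear f)
  then obtain a where "f = (\<lambda>x. x * a)"
    using real_bounded_linear by blast
  then show ?case
    using trig_polys_mult[OF assms(2) trig_polys_const[of a]] by simp
qed (auto intro: trig_polys_const trig_polys.add trig_polys_mult)

lemma trig_polys_separate:
  assumes "x \<noteq> y"
  shows "\<exists>f\<in>trig_polys. f x \<noteq> f y"
proof -
  define d where "d = x - y"
  have d: "d \<noteq> 0" using assms by (simp add: d_def)
  \<comment> \<open>This frequency puts \<open>x\<close> and \<open>y\<close> exactly half a period apart.\<close>
  define z where "z = of_real (pi / (cmod d)\<^sup>2) * d"
  have "d * cnj z = of_real pi"
    using d by (simp add: z_def complex_norm_square[symmetric] mult.left_commute[of d])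
  then have Re: "Re (x * cnj z) = Re (y * cnj z) + pi"
    by (simp add: d_def left_diff_distrib complex_eq_iff)
  define c where "c = cnj (iexp (Re (y * cnj z)))"
  have 1: "c * iexp (Re (y * cnj z)) = 1"
    unfolding c_def by (subst mult.commute, subst complex_norm_square[symmetric]) simp
  have "iexp (Re (x * cnj z)) = - iexp (Re (y * cnj z))"
    by (simp only: Re of_real_add ring_distribs exp_add) simp
  then have 2: "c * iexp (Re (x * cnj z)) = -1"
    using 1 by (metis mult_minus_right)
  show ?thesis
    by (rule bexI[OF _ trig_polys.wave[of c z]]) (simp only: 1 2, simp)
qed

text \<open>Stone and Weierstrass control the approximation on the compact set only; outside it a trigonometric polynomial
  could be far larger than \<open>f\<close>. Composing it with a real polynomial that is close to truncation at height \<open>B\<close>, on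
  the bounded range of the first approximation, repairs this without leaving the algebra.\<close>

lemma trig_polys_approx_bounded:
  fixes f :: "complex \<Rightarrow> real"
  assumes K: "compact K" and f: "continuous_on K f" and B: "\<And>w. \<bar>f w\<bar> \<le> B" and e: "0 < e"
  obtains g where "g \<in> trig_polys" "\<And>w. w \<in> K \<Longrightarrow> \<bar>f w - g w\<bar> < e" "\<And>w. \<bar>g w\<bar> \<le> B + e"
proof -
  interpret function_ring_on trig_polys K
    by unfold_locales
       (use K in \<open>auto intro: trig_polys_continuous trig_polys.add trig_polys_mult trig_polys_const trig_polys_separate\<close>)
  obtain g where g: "g \<in> trig_polys" "\<forall>w\<in>K. \<bar>f w - g w\<bar> < e / 2"
    using Stone_Weierstrass_basic[OF f, of "e/2"] e by auto
  obtain C where C: "\<And>w. \<bar>g w\<bar> \<le> C" using trig_polys_bounded[OF g(1)] by blast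
  define clamp where "clamp t = max (- B) (min B t)" for t :: real
  have B0: "0 \<le> B" using B[of 0] by linarith
  have "continuous_on {-C..C} clamp" unfolding clamp_def by (intro continuous_intros)
  then obtain p :: "real \<Rightarrow> real" where p: "real_polynomial_function p"
      "\<And>t. t \<in> {-C..C} \<Longrightarrow> \<bar>clamp t - p t\<bar> < e / 2"
    using Stone_Weierstrass_real_polynomial_function[of "{-C..C}" clamp "e/2"] e by auto
  have pg: "\<bar>clamp (g w) - p (g w)\<bar> < e / 2" for w
    using C[of w] by (intro p(2)) auto
  show ?thesis
  proof (rule that[OF trig_polys_real_polynomial[OF p(1) g(1)]])
    fix w assume "w \<in> K"
    then have "\<bar>f w - g w\<bar> < e / 2" using g by auto
    moreover have "\<bar>f w - clamp (g w)\<bar> \<le> \<bar>f w - g w\<bar>"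
      using B[of w] unfolding clamp_def by linarith
    ultimately show "\<bar>f w - p (g w)\<bar> < e" using pg[of w] by linarith
  next
    fix w
    have "\<bar>clamp (g w)\<bar> \<le> B" unfolding clamp_def using B0 by linarith
    then show "\<bar>p (g w)\<bar> \<le> B + e" using pg[of w] e by linarith
  qed
qed

lemma (in prob_space) integrable_cf:
  assumes [measurable]: "Z \<in> borel_measurable M"
  shows "integrable M (\<lambda>\<omega>. iexp (Re (Z \<omega> * cnj z)))"
  by (rule integrable_const_bound[of _ 1]) (auto simp del: of_real_mult times_complex.sel)

lemma trig_polys_measurable[measurable_dest]: "g \<in> trig_polys \<Longrightarrow> g \<in> borel_measurable borel"
  by (intro borel_measurable_continuous_onI trig_polys_continuous)

lemma (in prob_space) integrable_trig_polys:
  assumes [measurable]: "Z \<in> borel_measurable M" and g: "g \<in> trig_polys"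
  shows "integrable M (\<lambda>\<omega>. g (Z \<omega>))"
proof -
  have [measurable]: "g \<in> borel_measurable borel" using g by (rule trig_polys_measurable)
  obtain B where "\<And>w. \<bar>g w\<bar> \<le> B" using trig_polys_bounded[OF g] by blast
  then show ?thesis by (intro integrable_const_bound[of _ B]) auto
qed

lemma trig_polys_integral_tendsto:
  fixes Z :: "nat \<Rightarrow> 'a \<Rightarrow> complex"
  assumes M: "prob_space M" and Z: "\<And>N. Z N \<in> borel_measurable M"
    and S: "prob_space S" "sets S = sets borel"
    and cf: "\<And>z. (\<lambda>N. \<integral>\<omega>. iexp (Re (Z N \<omega> * cnj z)) \<partial>M) \<longlonglongrightarrow> (\<integral>w. iexp (Re (w * cnj z)) \<partial>S)"
    and g: "g \<in> trig_polys"
  shows "(\<lambda>N. \<integral>\<omega>. g (Z N \<omega>) \<partial>M) \<longlonglongrightarrow> (\<integral>w. g w \<partial>S)"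
proof -
  interpret M: prob_space M by fact
  interpret S: prob_space S by fact
  have id: "(\<lambda>w. w) \<in> borel_measurable S" using S(2) by (simp cong: measurable_cong_sets)
  show ?thesis using g
  proof (induction rule: trig_polys.induct)
    case (wave c z)
    have "(\<integral>\<omega>. Re (c * iexp (Re (Z N \<omega> * cnj z))) \<partial>M) = Re (c * (\<integral>\<omega>. iexp (Re (Z N \<omega> * cnj z)) \<partial>M))" for N
      by (subst integral_Re) (auto intro!: M.integrable_cf Z simp del: of_real_mult times_complex.sel)
    moreover have "(\<integral>w. Re (c * iexp (Re (w * cnj z))) \<partial>S) = Re (c * (\<integral>w. iexp (Re (w * cnj z)) \<partial>S))"
      by (subst integral_Re) (auto intro!: S.integrable_cf[OF id] simp del: of_real_mult times_complex.sel)
    ultimately show ?case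
      by (simp only:) (intro tendsto_intros cf)
  next
    case (add f g)
    have "(\<integral>\<omega>. f (Z N \<omega>) + g (Z N \<omega>) \<partial>M) = (\<integral>\<omega>. f (Z N \<omega>) \<partial>M) + (\<integral>\<omega>. g (Z N \<omega>) \<partial>M)" for N
      by (intro Bochner_Integration.integral_add M.integrable_trig_polys Z add.hyps)
    moreover have "(\<integral>w. f w + g w \<partial>S) = (\<integral>w. f w \<partial>S) + (\<integral>w. g w \<partial>S)"
      by (intro Bochner_Integration.integral_add S.integrable_trig_polys[OF id] add.hyps)
    ultimately show ?case
      by (simp only:) (intro tendsto_intros add.IH)
  qed
qed

text \<open>The tail of the limit is small, and the continuous function \<open>h k\<close>, which vanishes on \<open>[- k, k]\<close> and is
  1 off \<open>[- k - 1, k + 1]\<close>, transfers this to the approximating laws.\<close>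

lemma weak_limit_tail_small:
  fixes \<mu> :: "nat \<Rightarrow> real measure"
  assumes \<mu>: "\<And>n. real_distribution (\<mu> n)" and \<nu>: "real_distribution \<nu>"
    and w: "weak_conv_m \<mu> \<nu>" and e: "0 < e"
  obtains R where "0 < R" "measure \<nu> {x. R < \<bar>x\<bar>} < e" "\<forall>\<^sub>F n in sequentially. measure (\<mu> n) {x. R < \<bar>x\<bar>} < e"
proof -
  interpret \<mu>: real_distribution "\<mu> n" for n by fact
  interpret \<nu>: real_distribution \<nu> by fact
  define h where "h R x = max 0 (min 1 (\<bar>x\<bar> - R))" for R x :: real
  have h_cont: "isCont (h R) x" for R x unfolding h_def by (intro continuous_intros)
  have h_meas[measurable]: "h R \<in> borel_measurable borel" for R unfolding h_def by measurable
  have h_bd: "norm (h R x) \<le> 1" for R x unfolding h_def by auto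
  have "(\<lambda>k. \<integral>x. h (real k) x \<partial>\<nu>) \<longlonglongrightarrow> (\<integral>x. 0 \<partial>\<nu>)"
  proof (rule integral_dominated_convergence[where w="\<lambda>_. 1"])
    show "AE x in \<nu>. (\<lambda>k. h (real k) x) \<longlonglongrightarrow> 0"
    proof (rule AE_I2)
      fix x :: real
      have "\<forall>\<^sub>F k in sequentially. h (real k) x = 0"
      proof -
        have "\<forall>\<^sub>F k in sequentially. \<bar>x\<bar> \<le> real k" by real_asymp
        then show ?thesis by eventually_elim (auto simp: h_def)
      qed
      then show "(\<lambda>k. h (real k) x) \<longlonglongrightarrow> 0" by (rule tendsto_eventually)
    qed
  qed (use h_bd in auto)
  then have "\<forall>\<^sub>F k in sequentially. (\<integral>x. h (real k) x \<partial>\<nu>) < e"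
    using e by (auto dest: order_tendstoD)
  then obtain k where k: "(\<integral>x. h (real k) x \<partial>\<nu>) < e"
    by (auto simp: eventually_sequentially)
  define R where "R = real k + 1"
  have tail: "measure Q {x. R < \<bar>x\<bar>} \<le> (\<integral>x. h (real k) x \<partial>Q)" if "real_distribution Q" for Q
  proof -
    interpret Q: real_distribution Q by fact
    have "measure Q {x. R < \<bar>x\<bar>} = (\<integral>x. indicator {x. R < \<bar>x\<bar>} x \<partial>Q)" by simp
    also have "\<dots> \<le> (\<integral>x. h (real k) x \<partial>Q)"
    proof (rule integral_mono)
      show "integrable Q (indicat_real {x. R < \<bar>x\<bar>})"
        by (intro integrable_real_indicator) (auto simp: Q.emeasure_eq_measure)
      show "integrable Q (h (real k))" by (rule Q.integrable_const_bound[of _ 1]) (use h_bd in auto)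
      show "indicat_real {x. R < \<bar>x\<bar>} x \<le> h (real k) x" for x
        by (auto simp: h_def R_def indicator_def)
    qed
    finally show ?thesis .
  qed
  have "(\<lambda>n. integral\<^sup>L (\<mu> n) (h (real k))) \<longlonglongrightarrow> integral\<^sup>L \<nu> (h (real k))"
    by (rule weak_conv_imp_integral_bdd_continuous_conv[OF \<mu> \<nu> w h_cont h_bd])
  then have "\<forall>\<^sub>F n in sequentially. integral\<^sup>L (\<mu> n) (h (real k)) < e"
    using k by (auto dest: order_tendstoD)
  then have "\<forall>\<^sub>F n in sequentially. measure (\<mu> n) {x. R < \<bar>x\<bar>} < e"
    by eventually_elim (use tail[OF \<mu>] in \<open>auto intro: le_less_trans\<close>)
  moreover have "measure \<nu> {x. R < \<bar>x\<bar>} < e" using tail[OF \<nu>] k by linarith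
  ultimately show ?thesis using that[of R] by (simp add: R_def)
qed

text \<open>A projection of a complex random variable has the restriction of the planar characteristic function to a line as
  its own, so that the real-valued continuity theorem applies to it. This provides the tightness in the plane: it is
  used for the directions \<open>1\<close> and \<open>\<i>\<close>.\<close>

lemma coordinate_tails:
  fixes Z :: "nat \<Rightarrow> 'a \<Rightarrow> complex"
  assumes M: "prob_space M" and Z: "\<And>N. Z N \<in> borel_measurable M"
    and S: "prob_space S" "sets S = sets borel"
    and cf: "\<And>z. (\<lambda>N. \<integral>\<omega>. iexp (Re (Z N \<omega> * cnj z)) \<partial>M) \<longlonglongrightarrow> (\<integral>w. iexp (Re (w * cnj z)) \<partial>S)"
    and e: "0 < e"
  obtains R where "0 < R" "measure S {w. R < \<bar>Re (w * cnj u)\<bar>} < e"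
    "\<forall>\<^sub>F N in sequentially. measure M {\<omega>\<in>space M. R < \<bar>Re (Z N \<omega> * cnj u)\<bar>} < e"
proof -
  interpret M: prob_space M by fact
  interpret S: prob_space S by fact
  have id[measurable]: "(\<lambda>w. w) \<in> borel_measurable S" using S(2) by (simp cong: measurable_cong_sets)
  note Z[measurable]
  define \<mu> where "\<mu> N = distr M borel (\<lambda>\<omega>. Re (Z N \<omega> * cnj u))" for N
  define \<nu> where "\<nu> = distr S borel (\<lambda>w. Re (w * cnj u))"
  have \<mu>: "real_distribution (\<mu> N)" for N
    unfolding \<mu>_def by (rule M.real_distribution_distr) (simp del: times_complex.sel)
  have \<nu>: "real_distribution \<nu>"
    unfolding \<nu>_def by (rule S.real_distribution_distr) (simp del: times_complex.sel)
  have scale: "t * Re (w * cnj u) = Re (w * cnj (of_real t * u))" for t w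
    by (simp add: algebra_simps)
  have "weak_conv_m \<mu> \<nu>"
  proof (rule levy_continuity[OF \<mu> \<nu>])
    fix t
    have "char (\<mu> N) t = (\<integral>\<omega>. iexp (Re (Z N \<omega> * cnj (of_real t * u))) \<partial>M)" for N
      unfolding char_def \<mu>_def by (subst integral_distr) (simp_all only: scale, measurable)
    moreover have "char \<nu> t = (\<integral>w. iexp (Re (w * cnj (of_real t * u))) \<partial>S)"
      unfolding char_def \<nu>_def by (subst integral_distr) (simp_all only: scale, measurable)
    ultimately show "(\<lambda>N. char (\<mu> N) t) \<longlonglongrightarrow> char \<nu> t"
      using cf[of "of_real t * u"] by (simp only:)
  qed
  from weak_limit_tail_small[OF \<mu> \<nu> this e] obtain R where R: "0 < R" "measure \<nu> {x. R < \<bar>x\<bar>} < e"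
    "\<forall>\<^sub>F n in sequentially. measure (\<mu> n) {x. R < \<bar>x\<bar>} < e" by blast
  have spS: "space S = UNIV" using S(2) sets_eq_imp_space_eq[of S borel] by simp
  have "measure \<nu> {x. R < \<bar>x\<bar>} = measure S {w. R < \<bar>Re (w * cnj u)\<bar>}"
    unfolding \<nu>_def by (subst measure_distr) (auto simp: vimage_def spS simp del: times_complex.sel)
  moreover have "measure (\<mu> N) {x. R < \<bar>x\<bar>} = measure M {\<omega>\<in>space M. R < \<bar>Re (Z N \<omega> * cnj u)\<bar>}" for N
    unfolding \<mu>_def by (subst measure_distr) (auto simp: vimage_def Int_def conj_commute simp del: times_complex.sel)
  ultimately show ?thesis using that[OF R(1)] R(2,3) by (simp del: times_complex.sel)
qed

lemma (in prob_space) integral_diff_le_off_rectangle: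
  assumes [measurable]: "Z \<in> borel_measurable M" "f \<in> borel_measurable borel" "g \<in> borel_measurable borel"
    and f: "\<And>w. \<bar>f w\<bar> \<le> B" and g: "\<And>w. \<bar>g w\<bar> \<le> B + 1"
    and close: "\<And>w. \<bar>Re w\<bar> \<le> R1 \<Longrightarrow> \<bar>Im w\<bar> \<le> R2 \<Longrightarrow> \<bar>f w - g w\<bar> < e" and e: "0 \<le> e"
    and R1: "prob {\<omega>\<in>space M. R1 < \<bar>Re (Z \<omega>)\<bar>} \<le> d" and R2: "prob {\<omega>\<in>space M. R2 < \<bar>Im (Z \<omega>)\<bar>} \<le> d"
  shows "\<bar>expectation (\<lambda>\<omega>. f (Z \<omega>)) - expectation (\<lambda>\<omega>. g (Z \<omega>))\<bar> \<le> e + 2 * (2 * B + 1) * d"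
proof -
  let ?A = "{\<omega>\<in>space M. R1 < \<bar>Re (Z \<omega>)\<bar>}" and ?B = "{\<omega>\<in>space M. R2 < \<bar>Im (Z \<omega>)\<bar>}"
  have B: "0 \<le> B" using f[of 0] by linarith
  have if': "integrable M (\<lambda>\<omega>. f (Z \<omega>))" by (rule integrable_const_bound[of _ B]) (use f in auto)
  have ig: "integrable M (\<lambda>\<omega>. g (Z \<omega>))" by (rule integrable_const_bound[of _ "B+1"]) (use g in auto)
  have iA: "integrable M (indicat_real ?A)" and iB: "integrable M (indicat_real ?B)"
    by (auto intro!: integrable_real_indicator simp: emeasure_eq_measure)
  have "\<bar>expectation (\<lambda>\<omega>. f (Z \<omega>)) - expectation (\<lambda>\<omega>. g (Z \<omega>))\<bar> = \<bar>expectation (\<lambda>\<omega>. f (Z \<omega>) - g (Z \<omega>))\<bar>"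
    by (subst Bochner_Integration.integral_diff[OF if' ig]) simp
  also have "\<dots> \<le> expectation (\<lambda>\<omega>. \<bar>f (Z \<omega>) - g (Z \<omega>)\<bar>)"
    by (rule integral_abs_bound)
  also have "\<dots> \<le> expectation (\<lambda>\<omega>. e + (2 * B + 1) * indicat_real ?A \<omega> + (2 * B + 1) * indicat_real ?B \<omega>)"
  proof (rule integral_mono)
    fix \<omega> assume \<omega>: "\<omega> \<in> space M"
    have "\<bar>f (Z \<omega>) - g (Z \<omega>)\<bar> \<le> 2 * B + 1" using f[of "Z \<omega>"] g[of "Z \<omega>"] by linarith
    then show "\<bar>f (Z \<omega>) - g (Z \<omega>)\<bar> \<le> e + (2 * B + 1) * indicat_real ?A \<omega> + (2 * B + 1) * indicat_real ?B \<omega>"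
      using close[of "Z \<omega>"] e B \<omega> by (auto simp: indicator_def not_less split: if_splits)
  qed (use if' ig iA iB in \<open>auto intro!: Bochner_Integration.integrable_add integrable_abs\<close>)
  also have "\<dots> = e + (2 * B + 1) * prob ?A + (2 * B + 1) * prob ?B"
    using iA iB by (subst Bochner_Integration.integral_add | simp add: prob_space)+
  also have "\<dots> \<le> e + (2 * B + 1) * d + (2 * B + 1) * d"
    using B R1 R2 by (intro add_mono mult_left_mono) auto
  finally show ?thesis by (simp add: algebra_simps)
qed

text \<open>Expectations of trigonometric polynomials converge by hypothesis. A bounded continuous test function is uniformly
  close to one of them on a rectangle that carries nearly all the mass, and the global bound on the trigonometric
  polynomial makes the remainder negligible.\<close>

theorem complex_levy_continuity:
  fixes Z :: "nat \<Rightarrow> 'a \<Rightarrow> complex"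
  assumes M: "prob_space M" and Z: "\<And>N. Z N \<in> borel_measurable M"
    and S: "prob_space S" "sets S = sets borel"
    and cf: "\<And>z. (\<lambda>N. \<integral>\<omega>. iexp (Re (Z N \<omega> * cnj z)) \<partial>M) \<longlonglongrightarrow> (\<integral>w. iexp (Re (w * cnj z)) \<partial>S)"
  shows "converges_in_distribution M Z S"
  unfolding converges_in_distribution_def
proof (intro allI impI, elim conjE)
  fix f :: "complex \<Rightarrow> real" assume f: "continuous_on UNIV f" and "bounded (range f)"
  then obtain B where B: "\<And>w. \<bar>f w\<bar> \<le> B" by (auto simp: bounded_iff)
  have B0: "0 \<le> B" using B[of 0] by linarith
  have f_meas: "f \<in> borel_measurable borel" using f by (rule borel_measurable_continuous_onI)
  interpret M: prob_space M by fact
  interpret S: prob_space S by fact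
  have id: "(\<lambda>w. w) \<in> borel_measurable S" using S(2) by (simp cong: measurable_cong_sets)
  have spS: "space S = UNIV" using S(2) sets_eq_imp_space_eq[of S borel] by simp
  show "(\<lambda>N. \<integral>\<omega>. f (Z N \<omega>) \<partial>M) \<longlonglongrightarrow> (\<integral>w. f w \<partial>S)"
  proof (rule tendstoI)
    fix e :: real assume e: "0 < e"
    define d where "d = min 1 (e / 8)"
    have d: "0 < d" "d \<le> 1" "8 * d \<le> e" using e by (auto simp: d_def)
    \<comment> \<open>Makes the contribution of the two tails in \<open>integral_diff_le_off_rectangle\<close> equal to \<open>d\<close>.\<close>
    define d' where "d' = d / (2 * (2 * B + 1))"
    have d': "0 < d'" "2 * (2 * B + 1) * d' = d" using d B0 by (auto simp: d'_def)
    obtain R1 where R1: "measure S {w. R1 < \<bar>Re (w * cnj 1)\<bar>} < d'"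
      "\<forall>\<^sub>F N in sequentially. measure M {\<omega>\<in>space M. R1 < \<bar>Re (Z N \<omega> * cnj 1)\<bar>} < d'"
      using coordinate_tails[where Z=Z and u=1, OF M Z S cf d'(1)] .
    obtain R2 where R2: "measure S {w. R2 < \<bar>Re (w * cnj \<i>)\<bar>} < d'"
      "\<forall>\<^sub>F N in sequentially. measure M {\<omega>\<in>space M. R2 < \<bar>Re (Z N \<omega> * cnj \<i>)\<bar>} < d'"
      using coordinate_tails[where Z=Z and u=\<i>, OF M Z S cf d'(1)] .
    define K where "K = cbox (Complex (- R1) (- R2)) (Complex R1 R2)"
    have K: "w \<in> K \<longleftrightarrow> \<bar>Re w\<bar> \<le> R1 \<and> \<bar>Im w\<bar> \<le> R2" for w
      by (auto simp: K_def in_cbox_complex_iff abs_le_iff)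
    have "compact K" unfolding K_def by (rule compact_cbox)
    then obtain g where g: "g \<in> trig_polys" "\<And>w. w \<in> K \<Longrightarrow> \<bar>f w - g w\<bar> < d" "\<And>w. \<bar>g w\<bar> \<le> B + d"
      using trig_polys_approx_bounded[where K=K and f=f and B=B and e=d, OF _ continuous_on_subset[OF f subset_UNIV] B d(1)] by metis
    have g1: "\<bar>g w\<bar> \<le> B + 1" for w using g(3)[of w] d(2) by linarith
    have g_meas: "g \<in> borel_measurable borel" by (rule trig_polys_measurable[OF g(1)])
    have close: "\<bar>f w - g w\<bar> < d" if "\<bar>Re w\<bar> \<le> R1" "\<bar>Im w\<bar> \<le> R2" for w
      using g(2) K that by blast
    have "\<bar>(\<integral>w. f w \<partial>S) - (\<integral>w. g w \<partial>S)\<bar> \<le> d + 2 * (2 * B + 1) * d'"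
      by (rule S.integral_diff_le_off_rectangle[where Z="\<lambda>w. w" and f=f and g=g, OF id f_meas g_meas B g1 close less_imp_le[OF d(1)]])
         (use R1(1) R2(1) in \<open>auto simp: spS\<close>)
    then have limit: "\<bar>(\<integral>w. f w \<partial>S) - (\<integral>w. g w \<partial>S)\<bar> \<le> 2 * d" using d'(2) by simp
    have "\<forall>\<^sub>F N in sequentially. \<bar>(\<integral>\<omega>. g (Z N \<omega>) \<partial>M) - (\<integral>w. g w \<partial>S)\<bar> < d"
      using tendstoD[OF trig_polys_integral_tendsto[where Z=Z and g=g, OF M Z S cf g(1)] d(1)] by (simp add: dist_real_def)
    then show "\<forall>\<^sub>F N in sequentially. dist (\<integral>\<omega>. f (Z N \<omega>) \<partial>M) (\<integral>w. f w \<partial>S) < e"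
      using R1(2) R2(2)
    proof eventually_elim
      case (elim N)
      have "\<bar>(\<integral>\<omega>. f (Z N \<omega>) \<partial>M) - (\<integral>\<omega>. g (Z N \<omega>) \<partial>M)\<bar> \<le> d + 2 * (2 * B + 1) * d'"
        by (rule M.integral_diff_le_off_rectangle[where Z="Z N" and f=f and g=g, OF Z f_meas g_meas B g1 close less_imp_le[OF d(1)]])
           (use elim(2,3) in auto)
      then show ?case using limit elim(1) d d'(2) unfolding dist_real_def by linarith
    qed
  qed
qed

section \<open>Existence of the isotropic stable law\<close>

lemma exp_scaled_minus_one_tendsto:
  fixes L :: complex
  shows "(\<lambda>N. of_nat N * (exp (L / of_nat N) - 1)) \<longlonglongrightarrow> L"
proof (cases "L = 0")
  case False
  have "((\<lambda>h. (exp h - 1) / h) \<longlongrightarrow> 1) (at (0::complex))"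
    using DERIV_exp[of "0::complex"] by (simp add: DERIV_def)
  moreover have "filterlim (\<lambda>N. L / of_nat N) (at 0) sequentially"
  proof -
    have "(\<lambda>N. L / of_nat N) \<longlonglongrightarrow> 0" by (rule lim_const_over_n)
    moreover have "\<forall>\<^sub>F N in sequentially. L / of_nat N \<noteq> 0"
      using eventually_gt_at_top[of 0] by eventually_elim (use False in auto)
    ultimately show ?thesis by (simp add: filterlim_at)
  qed
  ultimately have "(\<lambda>N. (exp (L / of_nat N) - 1) / (L / of_nat N)) \<longlonglongrightarrow> 1"
    by (rule filterlim_compose)
  then have "(\<lambda>N. L * ((exp (L / of_nat N) - 1) / (L / of_nat N))) \<longlonglongrightarrow> L * 1"
    by (intro tendsto_intros)
  moreover have "L * ((exp (L / of_nat N) - 1) / (L / of_nat N)) = of_nat N * (exp (L / of_nat N) - 1)" for N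
    using False by (cases "N = 0") (auto simp: field_simps)
  ultimately show ?thesis by simp
qed simp

text \<open>Both \<open>u N\<close> and \<open>exp (L / N)\<close> lie in the closed unit disc, where raising to the \<open>N\<close>-th power increases distances at most
  by the factor \<open>N\<close>.\<close>

lemma power_tendsto_exp:
  fixes u :: "nat \<Rightarrow> complex"
  assumes u: "\<And>N. cmod (u N) \<le> 1" and L: "Re L \<le> 0"
    and lim: "(\<lambda>N. of_nat N * (u N - 1)) \<longlonglongrightarrow> L"
  shows "(\<lambda>N. u N ^ N) \<longlonglongrightarrow> exp L"
proof -
  define v where "v N = exp (L / of_nat N)" for N :: nat
  have v: "cmod (v N) \<le> 1" for N
    using L by (auto simp: v_def norm_exp_eq_Re divide_le_0_iff Re_divide_of_nat)
  have "(\<lambda>N. of_nat N * (u N - 1) - of_nat N * (v N - 1)) \<longlonglongrightarrow> L - L"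
    unfolding v_def by (intro tendsto_diff lim exp_scaled_minus_one_tendsto)
  then have "(\<lambda>N. cmod (of_nat N * (u N - v N))) \<longlonglongrightarrow> 0"
    using tendsto_norm_zero by (force simp: algebra_simps)
  then have "(\<lambda>N. u N ^ N - v N ^ N) \<longlonglongrightarrow> 0"
    by (rule Lim_null_comparison[rotated])
       (use norm_power_diff[OF u v] in \<open>auto simp: norm_mult\<close>)
  moreover have "(\<lambda>N. v N ^ N) \<longlonglongrightarrow> exp L"
  proof (rule tendsto_eventually)
    show "\<forall>\<^sub>F N in sequentially. v N ^ N = exp L"
      using eventually_gt_at_top[of 0]
      by eventually_elim (simp add: v_def exp_of_nat_mult[symmetric])
  qed
  ultimately have "(\<lambda>N. (u N ^ N - v N ^ N) + v N ^ N) \<longlonglongrightarrow> 0 + exp L" by (rule tendsto_add)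
  then show ?thesis by simp
qed

text \<open>Up to sign the coefficient of \<open>s ^ Suc k\<close> in the binomial series of \<open>(1 - s) powr a\<close>: the probability of the value
  \<open>Suc k\<close> under the Sibuya distribution.\<close>

definition sibuya_weight :: "real \<Rightarrow> nat \<Rightarrow> real" where
  "sibuya_weight a k = a * pochhammer (1 - a) k / fact (Suc k)"

lemma sibuya_weight_nonneg:
  assumes "0 < a" "a < 1" shows "0 \<le> sibuya_weight a k"
  unfolding sibuya_weight_def using assms by (intro divide_nonneg_pos mult_nonneg_nonneg pochhammer_nonneg) auto

lemma sibuya_weight_sums:
  assumes "\<bar>s\<bar> < 1"
  shows "(\<lambda>k. sibuya_weight a k * s ^ Suc k) sums (1 - (1 - s) powr a)"
proof -
  have "(\<lambda>n. (a gchoose n) * (- s) ^ n) sums (1 + (- s)) powr a"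
    using assms by (intro gen_binomial_real) auto
  then have "(\<lambda>n. (a gchoose Suc n) * (- s) ^ Suc n) sums ((1 - s) powr a - 1)"
    by (subst sums_Suc_iff) simp
  then have "(\<lambda>n. - ((a gchoose Suc n) * (- s) ^ Suc n)) sums (- ((1 - s) powr a - 1))"
    by (rule sums_minus)
  moreover have "- ((a gchoose Suc n) * (- s) ^ Suc n) = sibuya_weight a n * s ^ Suc n" for n
    unfolding gbinomial_pochhammer pochhammer_rec sibuya_weight_def power_minus[of s]
    by (simp add: power_mult_distrib[symmetric] del: fact_Suc power_Suc)
  ultimately show ?thesis by (simp only: minus_diff_eq)
qed

text \<open>The argument of Abel's theorem at \<open>s = 1\<close>; nonnegativity of the weights gives both inequalities.\<close>

lemma sibuya_weight_total:
  assumes a: "0 < a" "a < 1"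
  shows "sibuya_weight a sums 1"
proof -
  note nonneg = sibuya_weight_nonneg[OF a]
  have lim: "((\<lambda>s. 1 - (1 - s) powr a) \<longlongrightarrow> 1) (at_left (1::real))"
    using a by real_asymp
  have unit: "\<forall>\<^sub>F s in at_left (1::real). 0 < s \<and> s < 1"
    using eventually_at_left_real[of 0 1] by (auto elim: eventually_mono)
  have part: "(\<Sum>k<n. sibuya_weight a k) \<le> 1" for n
  proof (rule tendsto_upperbound)
    show "((\<lambda>s. \<Sum>k<n. sibuya_weight a k * s ^ Suc k) \<longlongrightarrow> (\<Sum>k<n. sibuya_weight a k)) (at_left 1)"
      by (rule tendsto_eq_intros refl | simp)+
    show "\<forall>\<^sub>F s in at_left 1. (\<Sum>k<n. sibuya_weight a k * s ^ Suc k) \<le> 1"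
      using unit
    proof eventually_elim
      case (elim s)
      have "(\<Sum>k<n. sibuya_weight a k * s ^ Suc k) \<le> 1 - (1 - s) powr a"
        using elim nonneg sibuya_weight_sums[of s a]
        by (intro order_trans[OF sum_le_suminf]) (auto simp: sums_iff)
      then show ?case by (smt (verit) powr_ge_zero)
    qed
  qed simp
  have summ: "summable (sibuya_weight a)"
    by (rule summableI_nonneg_bounded[OF nonneg part])
  have "suminf (sibuya_weight a) \<le> 1"
    by (rule suminf_le_const[OF summ part])
  moreover have "1 \<le> suminf (sibuya_weight a)"
  proof (rule tendsto_upperbound[OF lim])
    show "\<forall>\<^sub>F s in at_left 1. 1 - (1 - s) powr a \<le> suminf (sibuya_weight a)"
      using unit
    proof eventually_elim
      case (elim s)
      have "sibuya_weight a k * s ^ Suc k \<le> sibuya_weight a k" for k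
        using elim nonneg[of k] by (intro mult_left_le power_le_one) auto
      then show ?case
        using elim by (intro sums_le[OF _ sibuya_weight_sums summable_sums[OF summ]]) auto
    qed
  qed simp
  ultimately show ?thesis using summ by (simp add: sums_iff)
qed

text \<open>The Sibuya distribution is a discrete law in the domain of attraction of the positive \<open>a\<close>-stable one, chosen because
  its generating function is explicit.\<close>

lemma sibuya_pgf:
  assumes a: "0 < a" "a < 1"
  obtains p :: "nat pmf" where
    "\<And>s. 0 < s \<Longrightarrow> s < 1 \<Longrightarrow> (\<integral>\<^sup>+k. ennreal (s ^ k) \<partial>p) = ennreal (1 - (1 - s) powr a)"
proof -
  note nonneg = sibuya_weight_nonneg[OF a]
  have total: "(\<integral>\<^sup>+k. ennreal (sibuya_weight a k) \<partial>count_space UNIV) = 1"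
    using sibuya_weight_total[OF a] nonneg
    by (subst nn_integral_count_space_nat) (simp add: suminf_ennreal2 sums_iff)
  define p where "p = map_pmf Suc (embed_pmf (sibuya_weight a))"
  have "(\<integral>\<^sup>+k. ennreal (s ^ k) \<partial>p) = ennreal (1 - (1 - s) powr a)" if s: "0 < s" "s < 1" for s
  proof -
    have "(\<integral>\<^sup>+k. ennreal (s ^ k) \<partial>p) = (\<integral>\<^sup>+k. ennreal (s ^ Suc k) \<partial>embed_pmf (sibuya_weight a))"
      unfolding p_def by simp
    also have "\<dots> = (\<integral>\<^sup>+k. ennreal (sibuya_weight a k) * ennreal (s ^ Suc k) \<partial>count_space UNIV)"
      by (subst nn_integral_measure_pmf) (simp add: pmf_embed_pmf[OF nonneg total])
    also have "\<dots> = (\<Sum>k. ennreal (sibuya_weight a k * s ^ Suc k))"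
      using s nonneg by (subst nn_integral_count_space_nat) (simp add: ennreal_mult)
    also have "\<dots> = ennreal (1 - (1 - s) powr a)"
      using s nonneg sibuya_weight_sums[of s a]
      by (subst suminf_ennreal2) (auto simp: sums_iff)
    finally show ?thesis .
  qed
  then show ?thesis using that by blast
qed

text \<open>The law of a sum of \<open>n\<close> independent copies.\<close>

lemma pgf_power:
  fixes p :: "nat pmf"
  shows "\<exists>q :: nat pmf. \<forall>s\<ge>0. (\<integral>\<^sup>+k. ennreal (s ^ k) \<partial>q) = (\<integral>\<^sup>+k. ennreal (s ^ k) \<partial>p) ^ n"
proof (induction n)
  case 0
  show ?case by (rule exI[of _ "return_pmf 0"]) simp
next
  case (Suc n)
  then obtain q :: "nat pmf" where
    q: "\<And>s. 0 \<le> s \<Longrightarrow> (\<integral>\<^sup>+k. ennreal (s ^ k) \<partial>q) = (\<integral>\<^sup>+k. ennreal (s ^ k) \<partial>p) ^ n" by blast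
  show ?case
  proof (intro exI[of _ "map_pmf (\<lambda>(i, j). i + j) (pair_pmf p q)"] allI impI)
    fix s :: real assume s: "0 \<le> s"
    have "(\<integral>\<^sup>+k. ennreal (s ^ k) \<partial>map_pmf (\<lambda>(i, j). i + j) (pair_pmf p q)) =
          (\<integral>\<^sup>+i. \<integral>\<^sup>+j. ennreal (s ^ i) * ennreal (s ^ j) \<partial>q \<partial>p)"
      using s by (simp add: nn_integral_pair_pmf' power_add ennreal_mult)
    also have "\<dots> = (\<integral>\<^sup>+k. ennreal (s ^ k) \<partial>p) ^ Suc n"
      by (simp add: nn_integral_cmult nn_integral_multc q[OF s])
    finally show "(\<integral>\<^sup>+k. ennreal (s ^ k) \<partial>map_pmf (\<lambda>(i, j). i + j) (pair_pmf p q)) =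
      (\<integral>\<^sup>+k. ennreal (s ^ k) \<partial>p) ^ Suc n" .
  qed
qed

text \<open>The Laplace transform at \<open>l\<close> of \<open>m powr (- 1 / a)\<close> times a sum of \<open>m\<close> independent Sibuya variables.\<close>

definition sibuya_laplace :: "real \<Rightarrow> nat \<Rightarrow> real \<Rightarrow> real" where
  "sibuya_laplace a m l = (1 - (1 - exp (- l * real m powr (- 1 / a))) powr a) ^ m"

text \<open>The integrand involves \<open>max 0 x\<close> instead of \<open>x\<close> so that it is a bounded continuous function on the whole line, as
  the passage to a weak limit requires; the law itself lives on the positive half-line.\<close>

lemma scaled_sibuya_sum:
  assumes a: "0 < a" "a < 1" and m: "0 < m"
  obtains \<nu> where "real_distribution \<nu>" "AE x in \<nu>. 0 \<le> x"
    "\<And>l. 0 < l \<Longrightarrow> (\<integral>x. exp (- l * max 0 x) \<partial>\<nu>) = sibuya_laplace a m l"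
proof -
  obtain p :: "nat pmf" where p:
    "\<And>s. 0 < s \<Longrightarrow> s < 1 \<Longrightarrow> (\<integral>\<^sup>+k. ennreal (s ^ k) \<partial>p) = ennreal (1 - (1 - s) powr a)"
    using sibuya_pgf[OF a] by blast
  obtain q :: "nat pmf" where q: "\<And>s. 0 \<le> s \<Longrightarrow> (\<integral>\<^sup>+k. ennreal (s ^ k) \<partial>q) = (\<integral>\<^sup>+k. ennreal (s ^ k) \<partial>p) ^ m"
    using pgf_power[of p m] by blast
  define t where "t = real m powr (- 1 / a)"
  have t: "0 < t" using m by (simp add: t_def)
  define \<nu> where "\<nu> = distr (measure_pmf q) borel (\<lambda>k. real k * t)"
  have "real_distribution \<nu>"
    unfolding \<nu>_def by (rule prob_space.real_distribution_distr[OF prob_space_measure_pmf]) simp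
  moreover have "AE x in \<nu>. 0 \<le> x"
    unfolding \<nu>_def using t by (subst AE_distr_iff) auto
  moreover have "(\<integral>x. exp (- l * max 0 x) \<partial>\<nu>) = sibuya_laplace a m l" if l: "0 < l" for l
  proof -
    define s where "s = exp (- l * t)"
    have s: "0 < s" "s < 1" using l t by (auto simp: s_def)
    have le1: "(1 - s) powr a \<le> 1" using s a by (intro powr_le1) auto
    have "(\<integral>x. exp (- l * max 0 x) \<partial>\<nu>) = (\<integral>k. exp (- l * max 0 (real k * t)) \<partial>q)"
      unfolding \<nu>_def by (subst integral_distr) auto
    also have "\<dots> = (\<integral>k. s ^ k \<partial>q)"
      using t by (intro Bochner_Integration.integral_cong) (auto simp: s_def exp_of_nat_mult[symmetric] mult_ac)
    also have "\<dots> = enn2real (\<integral>\<^sup>+k. ennreal (s ^ k) \<partial>q)"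
      using s by (intro integral_eq_nn_integral) auto
    also have "\<dots> = (1 - (1 - s) powr a) ^ m"
      using s le1 by (subst q) (auto simp: p ennreal_power)
    finally show ?thesis by (simp add: s_def t_def sibuya_laplace_def)
  qed
  ultimately show ?thesis using that by blast
qed

lemma sibuya_laplace_tendsto:
  assumes a: "0 < a" "a < 1" and l: "0 < l"
  shows "(\<lambda>m. sibuya_laplace a m l) \<longlonglongrightarrow> exp (- (l powr a))"
proof -
  define u where "u m = 1 - (1 - exp (- l * real m powr (- 1 / a))) powr a" for m :: nat
  have u: "cmod (of_real (u m)) \<le> 1" for m
  proof -
    have "0 \<le> (1 - exp (- l * real m powr (- 1 / a))) powr a" by simp
    moreover have "(1 - exp (- l * real m powr (- 1 / a))) powr a \<le> 1"
      using a l by (intro powr_le1) auto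
    ultimately have "\<bar>u m\<bar> \<le> 1" unfolding u_def by linarith
    then show ?thesis by (simp only: norm_of_real)
  qed
  have "(\<lambda>m. real m * (u m - 1)) \<longlonglongrightarrow> - (l powr a)"
    unfolding u_def using a l by real_asymp
  then have "(\<lambda>m. complex_of_real (real m * (u m - 1))) \<longlonglongrightarrow> complex_of_real (- (l powr a))"
    by (rule tendsto_of_real)
  then have "(\<lambda>m. of_nat m * (complex_of_real (u m) - 1)) \<longlonglongrightarrow> complex_of_real (- (l powr a))"
    by simp
  then have "(\<lambda>m. complex_of_real (u m) ^ m) \<longlonglongrightarrow> exp (complex_of_real (- (l powr a)))"
    by (intro power_tendsto_exp u) auto
  then have "(\<lambda>m. complex_of_real (u m ^ m)) \<longlonglongrightarrow> complex_of_real (exp (- (l powr a)))"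
    by (simp only: of_real_power exp_of_real)
  then show ?thesis
    by (simp only: tendsto_of_real_iff u_def sibuya_laplace_def)
qed

text \<open>A bound uniform in \<open>m\<close> near \<open>l = 0\<close>, from \<open>1 - exp (- x) \<le> x\<close> and Bernoulli's inequality; it yields tightness.\<close>

lemma sibuya_laplace_ge:
  assumes a: "0 < a" "a < 1" and l: "0 < l" "l \<le> 1" and m: "0 < m"
  shows "1 - l powr a \<le> sibuya_laplace a m l"
proof -
  define y where "y = (1 - exp (- l * real m powr (- 1 / a))) powr a"
  have "1 - exp (- l * real m powr (- 1 / a)) \<le> l * real m powr (- 1 / a)"
    using exp_ge_add_one_self[of "- l * real m powr (- 1 / a)"] by linarith
  moreover have "0 \<le> 1 - exp (- l * real m powr (- 1 / a))" using l by simp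
  ultimately have "y \<le> (l * real m powr (- 1 / a)) powr a"
    unfolding y_def using a by (intro powr_mono2) auto
  also have "\<dots> = l powr a * (1 / m)"
    using a l m by (subst powr_mult) (auto simp: powr_powr powr_minus_divide powr_divide)
  finally have y: "real m * y \<le> l powr a" using m by (simp add: field_simps)
  have "y \<le> 1"
  proof -
    have "1 - exp (- l * real m powr (- 1 / a)) \<le> 1" by simp
    then show ?thesis unfolding y_def using a l by (intro powr_le1) auto
  qed
  then have "1 - real m * y \<le> (1 - y) ^ m"
    using Bernoulli_inequality[of "- y" m] by simp
  then show ?thesis using y unfolding sibuya_laplace_def y_def[symmetric] by linarith
qed

lemma (in real_distribution) upper_tail_le_laplace:
  assumes R: "0 < R"
  shows "prob {R<..} \<le> 2 * (1 - expectation (\<lambda>x. exp (- (1 / R) * max 0 x)))"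
proof -
  have int: "integrable M (\<lambda>x. exp (- (1 / R) * max 0 x))"
    using R by (intro integrable_const_bound[of _ 1]) auto
  have "prob {R<..} = expectation (indicat_real {R<..})" by simp
  also have "\<dots> \<le> expectation (\<lambda>x. 2 * (1 - exp (- (1 / R) * max 0 x)))"
  proof (rule integral_mono)
    show "integrable M (indicat_real {R<..})"
      by (intro integrable_real_indicator) (auto simp: emeasure_eq_measure)
    show "integrable M (\<lambda>x. 2 * (1 - exp (- (1 / R) * max 0 x)))"
      using int by auto
    fix x
    show "indicat_real {R<..} x \<le> 2 * (1 - exp (- (1 / R) * max 0 x))"
    proof (cases "R < x")
      case True
      then have "1 \<le> x / R" using R by simp
      have "2 \<le> exp (1::real)" using exp_ge_add_one_self[of 1] by simp
      also have "\<dots> \<le> exp (x / R)" using \<open>1 \<le> x / R\<close> by simp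
      finally have "exp (- (x / R)) \<le> 1 / 2" by (simp add: exp_minus field_simps)
      then show ?thesis using True R by (simp add: max_def)
    qed (use R in auto)
  qed
  also have "\<dots> = 2 * (1 - expectation (\<lambda>x. exp (- (1 / R) * max 0 x)))"
    using int by (simp del: space_eq_univ add: prob_space)
  finally show ?thesis .
qed

text \<open>Tightness of the scaled Sibuya sums gives a weak limit along a subsequence, and the limit of the Laplace
  transforms identifies it as \<open>a\<close>-stable.\<close>

lemma positive_stable_law_exists:
  assumes a: "0 < a" "a < 1"
  obtains \<nu> where "real_distribution \<nu>"
    "\<And>l. 0 \<le> l \<Longrightarrow> (\<integral>x. exp (- l * max 0 x) \<partial>\<nu>) = exp (- (l powr a))"
proof -
  have "\<exists>\<nu>. real_distribution \<nu> \<and> (AE x in \<nu>. 0 \<le> x) \<and>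
      (\<forall>l>0. (\<integral>x. exp (- l * max 0 x) \<partial>\<nu>) = sibuya_laplace a (Suc m) l)" for m
    using scaled_sibuya_sum[OF a, of "Suc m"] by (metis zero_less_Suc)
  then obtain \<mu> where \<mu>: "\<And>m. real_distribution (\<mu> m)" and pos: "\<And>m. AE x in \<mu> m. 0 \<le> x"
    and lap: "\<And>m l. 0 < l \<Longrightarrow> (\<integral>x. exp (- l * max 0 x) \<partial>\<mu> m) = sibuya_laplace a (Suc m) l"
    by metis
  have "tight \<mu>"
    unfolding tight_def
  proof (intro conjI allI impI \<mu>)
    fix e :: real assume e: "0 < e"
    \<comment> \<open>With this radius \<open>2 (1 / R) powr a\<close>, the bound on the tail, is at most \<open>e / 2\<close>.\<close>
    define R where "R = max 1 ((4 / e) powr (1 / a))"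
    have R: "1 \<le> R" by (simp add: R_def)
    have "4 / e = ((4 / e) powr (1 / a)) powr a" using a e by (simp add: powr_powr)
    also have "\<dots> \<le> R powr a" unfolding R_def using a by (intro powr_mono2) auto
    finally have "(1 / R) powr a \<le> e / 4"
      using R e by (simp add: powr_divide field_simps)
    \<comment> \<open>The lower end \<open>-1\<close> only has to be negative: the laws are carried by the positive half-line, and \<open>0\<close> must be included.\<close>
    have "measure (\<mu> m) {-1<..R} > 1 - e" for m
    proof -
      interpret real_distribution "\<mu> m" by fact
      have "prob {R<..} \<le> 2 * (1 - sibuya_laplace a (Suc m) (1 / R))"
        using upper_tail_le_laplace[of R] lap[of "1/R" m] R by simp
      also have "\<dots> \<le> 2 * (1 / R) powr a"
        using sibuya_laplace_ge[OF a, of "1/R" "Suc m"] R by simp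
      also have "\<dots> < e" using \<open>(1 / R) powr a \<le> e / 4\<close> e by linarith
      finally have up: "prob {R<..} < e" .
      have "1 = prob UNIV" using prob_space by simp
      also have "\<dots> = prob ({-1<..R} \<union> {R<..})"
        using pos[of m] R by (intro finite_measure_eq_AE) (auto elim: AE_mp)
      also have "\<dots> \<le> prob {-1<..R} + prob {R<..}" by (intro measure_Un_le) auto
      finally show ?thesis using up by linarith
    qed
    then show "\<exists>a b. a < b \<and> (\<forall>n. 1 - e < measure (\<mu> n) {a<..b})"
      using R by (intro exI[of _ "-1"] exI[of _ R]) auto
  qed
  from tight_imp_convergent_subsubsequence[OF this strict_mono_id]
  obtain r \<nu> where r: "strict_mono (r :: nat \<Rightarrow> nat)" and \<nu>: "real_distribution \<nu>" and "weak_conv_m (\<mu> \<circ> id \<circ> r) \<nu>"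
    by blast
  then have w: "weak_conv_m (\<lambda>n. \<mu> (r n)) \<nu>" by (simp add: comp_def)
  interpret \<nu>: real_distribution \<nu> by fact
  have "(\<integral>x. exp (- l * max 0 x) \<partial>\<nu>) = exp (- (l powr a))" if l: "0 < l" for l
  proof (rule LIMSEQ_unique)
    show "(\<lambda>n. \<integral>x. exp (- l * max 0 x) \<partial>\<mu> (r n)) \<longlonglongrightarrow> (\<integral>x. exp (- l * max 0 x) \<partial>\<nu>)"
      by (rule weak_conv_imp_integral_bdd_continuous_conv[OF \<mu> \<nu> w, where B=1])
         (use l in \<open>auto intro!: continuous_intros\<close>)
    have "(\<lambda>n. sibuya_laplace a (Suc (r n)) l) \<longlonglongrightarrow> exp (- (l powr a))"
      using LIMSEQ_subseq_LIMSEQ[OF LIMSEQ_Suc[OF sibuya_laplace_tendsto[OF a l]] r] by (simp add: comp_def)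
    then show "(\<lambda>n. \<integral>x. exp (- l * max 0 x) \<partial>\<mu> (r n)) \<longlonglongrightarrow> exp (- (l powr a))"
      by (simp only: lap[OF l])
  qed
  moreover have "(\<integral>x. exp (- 0 * max 0 x) \<partial>\<nu>) = exp (- (0 powr a))"
    using \<nu>.prob_space by simp
  ultimately show ?thesis using that[OF \<nu>] by (metis less_eq_real_def)
qed

lemma gauss_plane_cf:
  "(\<integral>p. iexp (Re (of_real r * Complex (fst p) (snd p) * cnj z)) \<partial>(gauss \<Otimes>\<^sub>M gauss))
     = of_real (exp (- (r\<^sup>2 * (cmod z)\<^sup>2 / 2)))"
proof -
  interpret G: real_distribution gauss by (rule real_dist_normal_dist)
  interpret GG: pair_prob_space gauss gauss ..
  have split: "iexp (Re (of_real r * Complex x y * cnj z)) = iexp ((r * Re z) * x) * iexp ((r * Im z) * y)" for x y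
    by (simp add: exp_add[symmetric] algebra_simps)
  have "integrable (gauss \<Otimes>\<^sub>M gauss) (\<lambda>p. iexp ((r * Re z) * fst p) * iexp ((r * Im z) * snd p))"
    by (rule GG.integrable_const_bound[of _ 1]) (auto simp: norm_mult simp del: of_real_mult)
  then have "(\<integral>p. iexp ((r * Re z) * fst p) * iexp ((r * Im z) * snd p) \<partial>(gauss \<Otimes>\<^sub>M gauss)) =
    (\<integral>x. (\<integral>y. iexp ((r * Re z) * x) * iexp ((r * Im z) * y) \<partial>gauss) \<partial>gauss)"
    by (subst GG.integral_fst'[symmetric]) auto
  also have "\<dots> = char gauss (r * Re z) * char gauss (r * Im z)"
    unfolding char_def by (simp del: of_real_mult)
  also have "\<dots> = of_real (exp (- (r\<^sup>2 * (cmod z)\<^sup>2 / 2)))"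
    unfolding char_std_normal_distribution of_real_mult[symmetric] exp_add[symmetric]
    by (simp add: cmod_power2 field_simps)
  finally show ?thesis by (simp only: split)
qed

text \<open>Subordination: conditionally on \<open>T\<close>, the variable \<open>sqrt (2 K T) (G + \<i> G')\<close> with independent standard Gaussian \<open>G\<close>, \<open>G'\<close> has
  characteristic function \<open>exp (- K T \<bar>z\<bar>\<^sup>2)\<close>. Integrating over a positive \<open>\<alpha> / 2\<close>-stable \<open>T\<close> evaluates the Laplace
  transform of \<open>T\<close> at \<open>K \<bar>z\<bar>\<^sup>2\<close>.\<close>

theorem isotropic_stable_law_exists:
  assumes \<alpha>: "0 < \<alpha>" "\<alpha> < 2" and c: "0 < c"
  obtains S where "prob_space S" "sets S = sets (borel :: complex measure)"
    "\<And>z. (\<integral>w. iexp (Re (w * cnj z)) \<partial>S) = of_real (exp (- c * cmod z powr \<alpha>))"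
proof -
  define a where "a = \<alpha> / 2"
  have a: "0 < a" "a < 1" using \<alpha> by (auto simp: a_def)
  obtain \<nu> where \<nu>: "real_distribution \<nu>" and
    lap: "\<And>l. 0 \<le> l \<Longrightarrow> (\<integral>x. exp (- l * max 0 x) \<partial>\<nu>) = exp (- (l powr a))"
    using positive_stable_law_exists[OF a] by blast
  define K where "K = c powr (1 / a)"
  have K: "0 < K" "K powr a = c" using c a by (auto simp: K_def powr_powr)
  interpret \<nu>: real_distribution \<nu> by fact
  interpret G: real_distribution gauss by (rule real_dist_normal_dist)
  interpret GG: pair_prob_space gauss gauss ..
  interpret P: pair_prob_space \<nu> "gauss \<Otimes>\<^sub>M gauss" ..
  define r where "r t = sqrt (2 * K * max 0 t)" for t
  define V where "V q = of_real (r (fst q)) * Complex (fst (snd q)) (snd (snd q))" for q :: "real \<times> real \<times> real"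
  have V[measurable]: "V \<in> borel_measurable (\<nu> \<Otimes>\<^sub>M (gauss \<Otimes>\<^sub>M gauss))"
    unfolding V_def r_def Complex_eq by measurable
  define S where "S = distr (\<nu> \<Otimes>\<^sub>M (gauss \<Otimes>\<^sub>M gauss)) borel V"
  show ?thesis
  proof (rule that)
    show "prob_space S" unfolding S_def by (rule P.prob_space_distr[OF V])
    show "sets S = sets (borel :: complex measure)" by (simp add: S_def)
    fix z
    have "integrable (\<nu> \<Otimes>\<^sub>M (gauss \<Otimes>\<^sub>M gauss)) (\<lambda>q. iexp (Re (V q * cnj z)))"
      by (rule P.integrable_const_bound[of _ 1]) (auto simp del: of_real_mult times_complex.sel)
    then have "(\<integral>q. iexp (Re (V q * cnj z)) \<partial>(\<nu> \<Otimes>\<^sub>M (gauss \<Otimes>\<^sub>M gauss))) =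
      (\<integral>t. (\<integral>p. iexp (Re (of_real (r t) * Complex (fst p) (snd p) * cnj z)) \<partial>(gauss \<Otimes>\<^sub>M gauss)) \<partial>\<nu>)"
      by (subst P.integral_fst'[symmetric]) (auto simp: V_def)
    also have "\<dots> = (\<integral>t. of_real (exp (- (K * (cmod z)\<^sup>2) * max 0 t)) \<partial>\<nu>)"
      unfolding gauss_plane_cf using K by (intro Bochner_Integration.integral_cong) (auto simp: r_def)
    also have "\<dots> = of_real (exp (- ((K * (cmod z)\<^sup>2) powr a)))"
      using K by (simp only: integral_complex_of_real) (subst lap, auto)
    also have "(K * (cmod z)\<^sup>2) powr a = c * cmod z powr \<alpha>"
    proof -
      have "(cmod z)\<^sup>2 powr a = cmod z powr \<alpha>"
      proof (cases "z = 0")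
        case False
        then have "(cmod z)\<^sup>2 powr a = (cmod z powr 2) powr a" by (simp add: powr_numeral)
        then show ?thesis unfolding powr_powr a_def by simp
      qed simp
      then show ?thesis using K powr_mult[of K "(cmod z)\<^sup>2" a] by simp
    qed
    finally show "(\<integral>w. iexp (Re (w * cnj z)) \<partial>S) = of_real (exp (- c * cmod z powr \<alpha>))"
      unfolding S_def by (subst integral_distr) auto
  qed
qed

section \<open>A Gaussian phase of large variance equidistributes\<close>

lemma cos_wave_series:
  assumes Q: "real_distribution Q"
  shows "(\<lambda>k. (\<i> * of_real R) ^ k / fact k * (\<integral>\<theta>. of_real (cos \<theta>) ^ k \<partial>Q)) sums (\<integral>\<theta>. iexp (R * cos \<theta>) \<partial>Q)"
proof -
  interpret real_distribution Q by fact
  define f where "f k \<theta> = (\<i> * of_real R) ^ k / fact k * of_real (cos \<theta>) ^ k" for k and \<theta> :: real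
  have bd: "norm (f k \<theta>) \<le> \<bar>R\<bar> ^ k / fact k" for k \<theta>
  proof -
    have "norm (f k \<theta>) = \<bar>R\<bar> ^ k / fact k * \<bar>cos \<theta>\<bar> ^ k"
      by (simp add: f_def norm_mult norm_divide norm_power)
    also have "\<dots> \<le> \<bar>R\<bar> ^ k / fact k" by (intro mult_left_le power_le_one) auto
    finally show ?thesis .
  qed
  have [measurable]: "f k \<in> borel_measurable borel" for k unfolding f_def by measurable
  have sumR: "summable (\<lambda>k. \<bar>R\<bar> ^ k / fact k)"
    using summable_exp[of "\<bar>R\<bar>"] by (simp add: field_simps)
  have int: "integrable Q (f k)" for k
    by (rule integrable_const_bound[of _ "\<bar>R\<bar> ^ k / fact k"]) (use bd in auto)
  have "(\<lambda>k. integral\<^sup>L Q (f k)) sums (\<integral>\<theta>. (\<Sum>k. f k \<theta>) \<partial>Q)"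
  proof (rule sums_integral[OF int])
    show "AE \<theta> in Q. summable (\<lambda>k. norm (f k \<theta>))"
      by (intro AE_I2 summable_comparison_test'[OF sumR]) (use bd in auto)
    have "(\<integral>\<theta>. norm (f k \<theta>) \<partial>Q) \<le> \<bar>R\<bar> ^ k / fact k" for k
      using bd int by (intro integral_le_const) auto
    then show "summable (\<lambda>k. \<integral>\<theta>. norm (f k \<theta>) \<partial>Q)"
      by (intro summable_comparison_test'[OF sumR]) (auto simp: integral_nonneg_AE)
  qed
  moreover have "(\<Sum>k. f k \<theta>) = iexp (R * cos \<theta>)" for \<theta>
    using exp_converges[of "\<i> * of_real (R * cos \<theta>)"]
    by (simp add: f_def sums_iff scaleR_conv_of_real power_mult_distrib field_simps)
  moreover have "integral\<^sup>L Q (f k) = (\<i> * of_real R) ^ k / fact k * (\<integral>\<theta>. of_real (cos \<theta>) ^ k \<partial>Q)" for k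
    unfolding f_def by (rule integral_mult_right_zero)
  ultimately show ?thesis by simp
qed

text \<open>Writing \<open>cos \<theta>\<close> as a sum of two exponentials lowers the power by one and shifts the frequency by one in either
  direction; the factor \<open>iexp (j \<theta>)\<close> is there to make this induction close.\<close>

lemma cos_power_char_tendsto:
  fixes Q :: "nat \<Rightarrow> real measure"
  assumes Q: "\<And>N. real_distribution (Q N)" and U: "real_distribution U"
    and lim: "\<And>j::int. (\<lambda>N. char (Q N) j) \<longlonglongrightarrow> char U j"
  shows "(\<lambda>N. \<integral>\<theta>. of_real (cos \<theta>) ^ k * iexp (of_int j * \<theta>) \<partial>Q N)
    \<longlonglongrightarrow> (\<integral>\<theta>. of_real (cos \<theta>) ^ k * iexp (of_int j * \<theta>) \<partial>U)"
proof (induction k arbitrary: j)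
  case 0
  show ?case using lim[of j] by (simp add: char_def)
next
  case (Suc k)
  let ?f = "\<lambda>j \<theta>. of_real (cos \<theta>) ^ k * iexp (of_int j * \<theta>)"
  have int: "integrable P (?f j)" if "real_distribution P" for P and j :: int
  proof -
    interpret real_distribution P by fact
    show ?thesis
      by (rule integrable_const_bound[of _ 1])
         (auto simp: norm_mult norm_power power_le_one simp del: of_real_mult)
  qed
  have step: "of_real (cos \<theta>) ^ Suc k * iexp (of_int j * \<theta>) = (?f (j + 1) \<theta> + ?f (j - 1) \<theta>) / 2" for \<theta>
  proof -
    have "of_real (cos \<theta>) = (exp (\<i> * of_real \<theta>) + exp (- (\<i> * of_real \<theta>))) / 2"
      by (simp add: cos_of_real[symmetric] cos_exp_eq)
    moreover have "iexp (of_int (j + 1) * \<theta>) = exp (\<i> * of_real \<theta>) * iexp (of_int j * \<theta>)"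
      by (simp add: exp_add[symmetric] algebra_simps)
    moreover have "iexp (of_int (j - 1) * \<theta>) = exp (- (\<i> * of_real \<theta>)) * iexp (of_int j * \<theta>)"
      by (simp add: exp_add[symmetric] algebra_simps)
    ultimately show ?thesis by (simp add: algebra_simps add_divide_distrib del: of_real_mult of_int_add of_int_diff)
  qed
  have rec: "(\<integral>\<theta>. of_real (cos \<theta>) ^ Suc k * iexp (of_int j * \<theta>) \<partial>P) =
    ((\<integral>\<theta>. ?f (j + 1) \<theta> \<partial>P) + (\<integral>\<theta>. ?f (j - 1) \<theta> \<partial>P)) / 2" if "real_distribution P" for P
    unfolding step integral_divide_zero
    by (simp only: Bochner_Integration.integral_add[OF int[OF that] int[OF that]])
  show ?case
    unfolding rec[OF Q] rec[OF U] by (intro tendsto_intros Suc.IH) simp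
qed

text \<open>The exponential series of \<open>iexp (R cos \<theta>)\<close> is dominated by that of \<open>exp \<bar>R\<bar>\<close>, uniformly in the law of \<open>\<theta>\<close>, so the
  limit may be taken term by term. Only integer frequencies occur because the wave has period
  \<open>2 pi\<close> in \<open>\<theta>\<close>.\<close>

lemma cos_wave_tendsto:
  fixes Q :: "nat \<Rightarrow> real measure"
  assumes Q: "\<And>N. real_distribution (Q N)" and U: "real_distribution U"
    and lim: "\<And>j::int. (\<lambda>N. char (Q N) j) \<longlonglongrightarrow> char U j"
  shows "(\<lambda>N. \<integral>\<theta>. iexp (R * cos \<theta>) \<partial>Q N) \<longlonglongrightarrow> (\<integral>\<theta>. iexp (R * cos \<theta>) \<partial>U)"
proof -
  define t where "t P k = (\<i> * of_real R) ^ k / fact k * (\<integral>\<theta>. of_real (cos \<theta>) ^ k \<partial>P)" for P k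
  have t_lim: "(\<lambda>N. t (Q N) k) \<longlonglongrightarrow> t U k" for k
    unfolding t_def using cos_power_char_tendsto[OF Q U lim, of k 0] by (intro tendsto_intros) simp
  have bd: "norm (t (Q N) k) \<le> \<bar>R\<bar> ^ k / fact k" for N k
  proof -
    interpret real_distribution "Q N" by fact
    have "norm (\<integral>\<theta>. complex_of_real (cos \<theta>) ^ k \<partial>Q N) \<le> (\<integral>\<theta>. norm (complex_of_real (cos \<theta>) ^ k) \<partial>Q N)"
      by (rule integral_norm_bound)
    also have "\<dots> \<le> 1"
      by (intro integral_le_const integrable_const_bound[of _ 1])
         (auto simp: norm_power power_le_one)
    finally have "norm (\<integral>\<theta>. complex_of_real (cos \<theta>) ^ k \<partial>Q N) \<le> 1" .
    then show ?thesis
      unfolding t_def norm_mult norm_divide norm_power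
      by (simp add: divide_right_mono mult_left_le)
  qed
  have "(\<forall>\<^sub>F N in sequentially. summable (\<lambda>k. norm (t (Q N) k))) \<and> summable (\<lambda>k. norm (t U k)) \<and>
    (\<lambda>N. \<Sum>k. t (Q N) k) \<longlonglongrightarrow> (\<Sum>k. t U k)"
  proof (rule tannerys_theorem[OF t_lim])
    show "\<forall>\<^sub>F (k, N) in sequentially \<times>\<^sub>F sequentially. norm (t (Q N) k) \<le> \<bar>R\<bar> ^ k / fact k"
      using bd by (intro always_eventually) auto
    show "summable (\<lambda>k. \<bar>R\<bar> ^ k / fact k)"
      using summable_exp[of "\<bar>R\<bar>"] by (simp add: field_simps)
  qed simp
  then show ?thesis
    using cos_wave_series[OF Q] cos_wave_series[OF U] by (simp add: t_def sums_iff)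
qed

definition circle_angle :: "real measure" where
  "circle_angle = density lborel (\<lambda>\<theta>. ennreal (indicator {- pi..pi} \<theta> / (2 * pi)))"

lemma circle_angle_distribution: "real_distribution circle_angle"
proof -
  have "emeasure circle_angle UNIV = (\<integral>\<^sup>+\<theta>. ennreal (1 / (2 * pi)) * indicator {- pi..pi} \<theta> \<partial>lborel)"
    unfolding circle_angle_def
    by (subst emeasure_density) (auto intro!: nn_integral_cong simp: indicator_def)
  also have "\<dots> = ennreal (1 / (2 * pi)) * ennreal (2 * pi)"
    by (subst nn_integral_cmult_indicator) auto
  also have "\<dots> = 1" by (simp add: ennreal_mult[symmetric])
  finally show ?thesis
    by (auto simp: real_distribution_def real_distribution_axioms_def circle_angle_def intro!: prob_spaceI)
qed

lemma char_circle_angle: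
  "char circle_angle (of_int j) = (if j = 0 then 1 else 0)"
proof (cases "j = 0")
  case True
  then show ?thesis using real_distribution.char_zero[OF circle_angle_distribution] by simp
next
  case False
  define F where "F \<theta> = iexp (of_int j * \<theta>) / (\<i> * of_int j)" for \<theta>
  have "(\<integral>\<theta>. indicator {- pi..pi} \<theta> *\<^sub>R iexp (of_int j * \<theta>) \<partial>lborel) = F pi - F (- pi)"
  proof (rule integral_FTC_Icc)
    fix \<theta>
    show "(F has_vector_derivative iexp (of_int j * \<theta>)) (at \<theta> within {- pi..pi})"
      unfolding F_def using False
      by (auto intro!: derivative_eq_intros has_vector_derivative_real_field simp: field_simps)
  qed (auto intro!: continuous_intros)
  also have "F pi = F (- pi)"
  proof -
    have "\<i> * complex_of_real (of_int j * pi) = \<i> * of_real (of_int j * - pi) + 2 * of_int j * of_real pi * \<i>"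
      by simp
    then have "iexp (of_int j * pi) = iexp (of_int j * - pi) * exp (2 * of_int j * of_real pi * \<i>)"
      by (simp only: exp_add)
    also have "exp (2 * of_int j * of_real pi * \<i>) = 1" by (auto simp: exp_eq_1)
    finally show ?thesis by (simp add: F_def)
  qed
  finally have "(\<integral>\<theta>. indicator {- pi..pi} \<theta> *\<^sub>R iexp (of_int j * \<theta>) \<partial>lborel) = 0" by simp
  then have "(\<integral>\<theta>. (1 / (2 * pi)) *\<^sub>R (indicator {- pi..pi} \<theta> *\<^sub>R iexp (of_int j * \<theta>)) \<partial>lborel) = 0"
    by (subst integral_scaleR_right) simp
  then show ?thesis
    unfolding char_def circle_angle_def using False by (subst integral_density) auto
qed

text \<open>The Bessel function of the first kind of order zero, as the mean of a plane wave over a circle.\<close>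

definition circle_mean :: "real \<Rightarrow> real" where
  "circle_mean R = (\<integral>\<theta>. cos (R * cos \<theta>) \<partial>circle_angle)"

text \<open>The mean is real since the rotation by \<open>pi\<close> leaves the uniform angle invariant and turns the wave into its
  conjugate. Invariance is read off the Fourier coefficients.\<close>

lemma circle_angle_wave: "(\<integral>\<theta>. iexp (R * cos \<theta>) \<partial>circle_angle) = of_real (circle_mean R)"
proof -
  interpret U: real_distribution circle_angle by (rule circle_angle_distribution)
  \<comment> \<open>The angle rotated by \<open>pi\<close>, which has the same Fourier coefficients.\<close>
  define Q where "Q = distr circle_angle borel (\<lambda>\<theta>. \<theta> + pi)"
  have Q: "real_distribution Q" unfolding Q_def by (rule U.real_distribution_distr) simp
  have char_Q: "char Q (of_int j) = char circle_angle (of_int j)" for j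
  proof -
    have "char Q (of_int j) = (\<integral>\<theta>. iexp (of_int j * pi) * iexp (of_int j * \<theta>) \<partial>circle_angle)"
      unfolding char_def Q_def by (subst integral_distr) (auto simp: exp_add[symmetric] algebra_simps)
    also have "\<dots> = iexp (of_int j * pi) * char circle_angle (of_int j)"
      unfolding char_def by (rule integral_mult_right_zero)
    finally show ?thesis by (simp add: char_circle_angle)
  qed
  let ?I = "\<integral>\<theta>. iexp (R * cos \<theta>) \<partial>circle_angle"
  have int: "integrable circle_angle (\<lambda>\<theta>. iexp (R * cos \<theta>))"
    by (rule U.integrable_const_bound[of _ 1]) (auto simp del: of_real_mult)
  have "(\<lambda>_::nat. \<integral>\<theta>. iexp (R * cos \<theta>) \<partial>Q) \<longlonglongrightarrow> ?I"
    by (rule cos_wave_tendsto[OF Q circle_angle_distribution]) (simp add: char_Q)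
  then have "(\<integral>\<theta>. iexp (R * cos \<theta>) \<partial>Q) = ?I"
    by (simp add: LIMSEQ_const_iff)
  also have "(\<integral>\<theta>. iexp (R * cos \<theta>) \<partial>Q) = (\<integral>\<theta>. cnj (iexp (R * cos \<theta>)) \<partial>circle_angle)"
    unfolding Q_def by (subst integral_distr) (auto simp: exp_cnj)
  also have "\<dots> = cnj ?I" by (rule Bochner_Integration.integral_cnj)
  finally have "Im ?I = 0" by (simp add: complex_eq_iff)
  moreover have "Re ?I = circle_mean R"
    unfolding circle_mean_def by (subst integral_Re[OF int, symmetric]) (simp add: Re_exp)
  ultimately show ?thesis by (simp add: complex_eq_iff)
qed

lemma one_minus_circle_mean:
  "1 - circle_mean R = (\<integral>\<theta>. 1 - cos (R * cos \<theta>) \<partial>circle_angle)"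
proof -
  interpret U: real_distribution circle_angle by (rule circle_angle_distribution)
  have "integrable circle_angle (\<lambda>\<theta>. cos (R * cos \<theta>))"
    by (rule U.integrable_const_bound[of _ 1]) auto
  then show ?thesis
    unfolding circle_mean_def by (simp del: U.space_eq_univ add: U.prob_space)
qed

lemma abs_one_minus_cos_le: "\<bar>1 - cos y\<bar> \<le> 2" for y :: real
  using cos_le_one[of y] cos_ge_minus_one[of y] by linarith

lemma one_minus_cos_le: "1 - cos y \<le> y\<^sup>2 / 2" for y :: real
proof -
  have "1 - cos y = 2 * (sin (y / 2))\<^sup>2" using cos_double_sin[of "y / 2"] by simp
  also have "\<dots> \<le> 2 * (y / 2)\<^sup>2"
    using abs_sin_x_le_abs_x[of "y / 2"] by (simp add: abs_le_square_iff[symmetric])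
  finally show ?thesis by (simp add: power_divide)
qed

text \<open>The constant bound serves large summands and the quadratic one small summands.\<close>

lemma circle_mean_bounds:
  "0 \<le> 1 - circle_mean R" "1 - circle_mean R \<le> 2" "1 - circle_mean R \<le> R\<^sup>2 / 2"
proof -
  interpret U: real_distribution circle_angle by (rule circle_angle_distribution)
  have int: "integrable circle_angle (\<lambda>\<theta>. 1 - cos (R * cos \<theta>))"
    by (rule U.integrable_const_bound[of _ 2]) (auto simp: abs_one_minus_cos_le)
  show "0 \<le> 1 - circle_mean R"
    unfolding one_minus_circle_mean by (rule integral_nonneg_AE) auto
  show "1 - circle_mean R \<le> 2"
    unfolding one_minus_circle_mean by (rule U.integral_le_const[OF int]) (use abs_one_minus_cos_le in \<open>auto simp: abs_le_iff simp del: diff_le_eq intro!: AE_I2\<close>)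
  have "1 - cos (R * cos \<theta>) \<le> R\<^sup>2 / 2" for \<theta>
  proof -
    have "(R * cos \<theta>)\<^sup>2 \<le> R\<^sup>2"
      using mult_left_le[of "(cos \<theta>)\<^sup>2" "R\<^sup>2"] by (simp add: power_mult_distrib abs_square_le_1)
    then show ?thesis using one_minus_cos_le[of "R * cos \<theta>"] by simp
  qed
  then show "1 - circle_mean R \<le> R\<^sup>2 / 2"
    unfolding one_minus_circle_mean by (intro U.integral_le_const[OF int]) auto
qed

text \<open>For \<open>0 < R \<le> 1\<close> the equality \<open>cos (R cos \<theta>) = 1\<close> forces \<open>cos \<theta> = 0\<close>, which contradicts that the mean of \<open>(cos \<theta>)\<^sup>2\<close>
  is \<open>1 / 2\<close>.\<close>

lemma circle_mean_less_1:
  assumes R: "0 < R" "R \<le> 1"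
  shows "circle_mean R < 1"
proof (rule ccontr)
  interpret U: real_distribution circle_angle by (rule circle_angle_distribution)
  assume "\<not> circle_mean R < 1"
  then have "(\<integral>\<theta>. 1 - cos (R * cos \<theta>) \<partial>circle_angle) = 0"
    using circle_mean_bounds(1)[of R] one_minus_circle_mean[of R] by linarith
  moreover have "integrable circle_angle (\<lambda>\<theta>. 1 - cos (R * cos \<theta>))"
    by (rule U.integrable_const_bound[of _ 2]) (auto simp: abs_one_minus_cos_le)
  ultimately have "AE \<theta> in circle_angle. 1 - cos (R * cos \<theta>) = 0"
    by (subst (asm) integral_nonneg_eq_0_iff_AE) auto
  then have "AE \<theta> in circle_angle. cos \<theta> = 0"
  proof eventually_elim
    case (elim \<theta>)
    show ?case
    proof (rule ccontr)
      assume "cos \<theta> \<noteq> 0"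
      then have "0 < \<bar>R * cos \<theta>\<bar>" "\<bar>R * cos \<theta>\<bar> \<le> 1" using R by (auto simp: abs_mult mult_le_one)
      then have "cos \<bar>R * cos \<theta>\<bar> < cos 0"
        using pi_gt3 by (intro cos_monotone_0_pi) auto
      then show False using elim by simp
    qed
  qed
  then have "(\<integral>\<theta>. of_real (cos \<theta>) ^ 2 * iexp (of_int 0 * \<theta>) \<partial>circle_angle) = (\<integral>\<theta>. (0::complex) \<partial>circle_angle)"
    by (intro integral_cong_AE) auto
  moreover have "(\<integral>\<theta>. of_real (cos \<theta>) ^ 2 * iexp (of_int 0 * \<theta>) \<partial>circle_angle) = 1 / 2"
  proof -
    have "complex_of_real (cos \<theta>) ^ 2 = 1 / 2 + (iexp (of_int 2 * \<theta>) + iexp (of_int (-2) * \<theta>)) / 4" for \<theta>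
    proof -
      let ?e = "exp (\<i> * complex_of_real \<theta>)" and ?e' = "exp (- (\<i> * complex_of_real \<theta>))"
      have "complex_of_real (cos \<theta>) = (?e + ?e') / 2"
        by (simp add: cos_of_real[symmetric] cos_exp_eq)
      then have "complex_of_real (cos \<theta>) ^ 2 = (2 * (?e * ?e') + (?e * ?e + ?e' * ?e')) / 4"
        by (simp only: power2_eq_square) (simp add: field_simps)
      moreover have "iexp (of_int 2 * \<theta>) = ?e * ?e" "iexp (of_int (-2) * \<theta>) = ?e' * ?e'"
        by (simp_all add: exp_add[symmetric] algebra_simps)
      moreover have "?e * ?e' = 1" by (simp add: exp_add[symmetric])
      ultimately show ?thesis by (simp only: add_divide_distrib) simp
    qed
    moreover have "integrable circle_angle (\<lambda>\<theta>. iexp (of_int j * \<theta>))" for j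
      by (rule U.integrable_const_bound[of _ 1]) (auto simp del: of_real_mult)
    ultimately have "(\<integral>\<theta>. complex_of_real (cos \<theta>) ^ 2 \<partial>circle_angle) =
        1 / 2 + (char circle_angle (of_int 2) + char circle_angle (of_int (-2))) / 4"
      unfolding char_def by (simp del: of_real_mult of_int_numeral of_int_minus U.space_eq_univ add: U.prob_space)
    then show ?thesis unfolding char_circle_angle by simp
  qed
  ultimately show False by simp
qed

lemma gauss_phase_char:
  "(\<integral>\<xi>. iexp (t * (\<mu> + v * \<xi>)) \<partial>gauss) = iexp (t * \<mu>) * of_real (exp (- ((t * v)\<^sup>2 / 2)))"
proof -
  have "(\<integral>\<xi>. iexp (t * (\<mu> + v * \<xi>)) \<partial>gauss) =
    (\<integral>\<xi>. iexp (t * \<mu>) * iexp ((t * v) * \<xi>) \<partial>gauss)"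
    by (intro Bochner_Integration.integral_cong) (auto simp: exp_add[symmetric] algebra_simps)
  also have "\<dots> = iexp (t * \<mu>) * char gauss (t * v)"
    unfolding char_def by (rule integral_mult_right_zero)
  finally show ?thesis unfolding char_std_normal_distribution by simp
qed

lemma wide_gauss_phase_char_tendsto_0:
  fixes \<mu> v :: "nat \<Rightarrow> real"
  assumes v: "filterlim (\<lambda>N. (v N)\<^sup>2) at_top sequentially" and t: "t \<noteq> 0"
  shows "(\<lambda>N. \<integral>\<xi>. iexp (t * (\<mu> N + v N * \<xi>)) \<partial>gauss) \<longlonglongrightarrow> 0"
proof (rule tendsto_norm_zero_cancel)
  have "filterlim (\<lambda>N. t\<^sup>2 / 2 * (v N)\<^sup>2) at_top sequentially"
    using t by (intro filterlim_tendsto_pos_mult_at_top[OF tendsto_const _ v]) auto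
  then have "(\<lambda>N. exp (- (t\<^sup>2 / 2 * (v N)\<^sup>2))) \<longlonglongrightarrow> 0"
    by (intro filterlim_compose[OF exp_at_bot] filterlim_compose[OF filterlim_uminus_at_bot_at_top])
  then show "(\<lambda>N. norm (\<integral>\<xi>. iexp (t * (\<mu> N + v N * \<xi>)) \<partial>gauss)) \<longlonglongrightarrow> 0"
    unfolding gauss_phase_char by (simp add: norm_mult power_mult_distrib del: of_real_mult)
qed

text \<open>The nonzero Fourier coefficients of a Gaussian angle decay with its variance, uniformly in the drift \<open>\<mu>\<close>; the wave
  therefore averages as over the uniform circle.\<close>

lemma wide_gauss_phase_wave_tendsto:
  fixes \<mu> v :: "nat \<Rightarrow> real"
  assumes v: "filterlim (\<lambda>N. (v N)\<^sup>2) at_top sequentially"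
  shows "(\<lambda>N. \<integral>\<xi>. iexp (R * cos (\<mu> N + v N * \<xi>)) \<partial>gauss) \<longlonglongrightarrow> of_real (circle_mean R)"
proof -
  interpret G: real_distribution gauss by (rule real_dist_normal_dist)
  define Q where "Q N = distr gauss borel (\<lambda>\<xi>. \<mu> N + v N * \<xi>)" for N
  have Q: "real_distribution (Q N)" for N unfolding Q_def by (rule G.real_distribution_distr) simp
  have char_Q: "char (Q N) t = (\<integral>\<xi>. iexp (t * (\<mu> N + v N * \<xi>)) \<partial>gauss)" for N t
    unfolding char_def Q_def by (subst integral_distr) auto
  have "(\<lambda>N. \<integral>\<theta>. iexp (R * cos \<theta>) \<partial>Q N) \<longlonglongrightarrow> (\<integral>\<theta>. iexp (R * cos \<theta>) \<partial>circle_angle)"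
  proof (rule cos_wave_tendsto[OF Q circle_angle_distribution])
    fix j :: int
    show "(\<lambda>N. char (Q N) (of_int j)) \<longlonglongrightarrow> char circle_angle (of_int j)"
    proof (cases "j = 0")
      case True
      then show ?thesis using real_distribution.char_zero[OF Q] char_circle_angle[of 0] by simp
    next
      case False
      then show ?thesis
        unfolding char_Q char_circle_angle using wide_gauss_phase_char_tendsto_0[OF v, of "of_int j" \<mu>] by simp
    qed
  qed
  moreover have "(\<integral>\<theta>. iexp (R * cos \<theta>) \<partial>Q N) = (\<integral>\<xi>. iexp (R * cos (\<mu> N + v N * \<xi>)) \<partial>gauss)" for N
    unfolding Q_def by (subst integral_distr) auto
  ultimately show ?thesis by (simp only: circle_angle_wave)
qed

lemma iexp_taylor1: "cmod (iexp t - 1 - \<i> * of_real t) \<le> t\<^sup>2 / 2"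
  using iexp_approx1[of t 1] by (simp add: algebra_simps power2_eq_square)

text \<open>The remainder of \<open>iexp (R cos \<theta>)\<close> after the Taylor terms that are subtracted: both of the first two for a small
  summand, the constant one alone for a large summand.\<close>

definition polar_excess :: "real \<Rightarrow> bool \<Rightarrow> real \<Rightarrow> complex" where
  "polar_excess R small \<theta> = iexp (R * cos \<theta>) - 1 - \<i> * of_real (if small then R * cos \<theta> else 0)"

lemma polar_excess_bound:
  "cmod (polar_excess R True \<theta>) \<le> R\<^sup>2 / 2" "cmod (polar_excess R False \<theta>) \<le> 2"
proof -
  have "cmod (polar_excess R True \<theta>) \<le> (R * cos \<theta>)\<^sup>2 / 2"
    using iexp_taylor1[of "R * cos \<theta>"] by (simp add: polar_excess_def)
  also have "(R * cos \<theta>)\<^sup>2 \<le> R\<^sup>2"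
    using mult_left_le[of "(cos \<theta>)\<^sup>2" "R\<^sup>2"] by (simp add: power_mult_distrib abs_square_le_1)
  finally show "cmod (polar_excess R True \<theta>) \<le> R\<^sup>2 / 2" by simp
  have "cmod (iexp (R * cos \<theta>) - 1) \<le> cmod (iexp (R * cos \<theta>)) + cmod 1" by (rule norm_triangle_ineq4)
  then show "cmod (polar_excess R False \<theta>) \<le> 2" by (simp add: polar_excess_def del: of_real_mult)
qed

lemma polar_excess_measurable[measurable (raw)]:
  assumes [measurable]: "f \<in> borel_measurable M" "Measurable.pred M P" "g \<in> borel_measurable M"
  shows "(\<lambda>x. polar_excess (f x) (P x) (g x)) \<in> borel_measurable M"
  unfolding polar_excess_def by measurable

section \<open>The normalising sequence and the scale of the limit\<close>

text \<open>The function \<open>x exp (x\<^sup>2 / 2)\<close> is bounded above on every half-line \<open>(- \<infinity>, K)\<close>, so that \<open>b N < K\<close> is impossible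
  once \<open>N\<close> is large.\<close>

lemma normalising_sequence_at_top:
  fixes b :: "nat \<Rightarrow> real"
  assumes b: "(\<lambda>N. sqrt (2 * pi) * b N * exp ((b N)\<^sup>2 / 2)) \<sim>[sequentially] (\<lambda>N. real N)"
  shows "filterlim b at_top sequentially"
  unfolding filterlim_at_top_gt[where c=0]
proof (intro allI impI)
  fix K :: real assume K: "0 < K"
  have "(\<lambda>N. sqrt (2 * pi) * b N * exp ((b N)\<^sup>2 / 2) / real N) \<longlonglongrightarrow> 1"
    by (rule asymp_equivD_strong[OF b]) (rule eventually_mono[OF eventually_gt_at_top[of 0]], simp)
  then have "\<forall>\<^sub>F N in sequentially. 1 / 2 < sqrt (2 * pi) * b N * exp ((b N)\<^sup>2 / 2) / real N"
    by (rule order_tendstoD) simp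
  moreover have "\<forall>\<^sub>F N in sequentially. 2 * (sqrt (2 * pi) * K * exp (K\<^sup>2 / 2)) < real N"
    by (rule eventually_compose_filterlim[OF eventually_gt_at_top filterlim_real_sequentially])
  moreover have "\<forall>\<^sub>F N in sequentially. 0 < (N::nat)" by (rule eventually_gt_at_top)
  ultimately show "\<forall>\<^sub>F N in sequentially. K \<le> b N"
  proof eventually_elim
    case (elim N)
    show ?case
    proof (rule ccontr)
      assume *: "\<not> K \<le> b N"
      have big: "real N / 2 < sqrt (2 * pi) * b N * exp ((b N)\<^sup>2 / 2)"
        using elim by (simp add: field_simps)
      have "0 < b N"
      proof (rule ccontr)
        assume "\<not> 0 < b N"
        then have "sqrt (2 * pi) * b N * exp ((b N)\<^sup>2 / 2) \<le> 0"
          by (intro mult_nonpos_nonneg mult_nonneg_nonpos) auto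
        then show False using big by simp
      qed
      then have "sqrt (2 * pi) * b N * exp ((b N)\<^sup>2 / 2) \<le> sqrt (2 * pi) * K * exp (K\<^sup>2 / 2)"
        using * K by (intro mult_mono) (auto intro!: power_mono)
      then show False using big elim(2) by linarith
    qed
  qed
qed

text \<open>Taking logarithms in the defining relation gives \<open>ln N = b\<^sup>2 / 2 + ln b + O(1)\<close>, hence the first limit. The relation also
  says that \<open>N std_normal_density b\<close> is asymptotic to \<open>b\<close>, the Mills ratio, hence the second.\<close>

lemma normalising_sequence_asymptotics:
  fixes b :: "nat \<Rightarrow> real"
  assumes b: "(\<lambda>N. sqrt (2 * pi) * b N * exp ((b N)\<^sup>2 / 2)) \<sim>[sequentially] (\<lambda>N. real N)"
  shows "(\<lambda>N. b N / sqrt (ln (real N))) \<longlonglongrightarrow> sqrt 2"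
    and "(\<lambda>N. real N / sqrt (ln (real N)) * std_normal_density (b N)) \<longlonglongrightarrow> sqrt 2"
proof -
  note top = normalising_sequence_at_top[OF b]
  have pos: "\<forall>\<^sub>F N in sequentially. 0 < b N" using top by (simp add: filterlim_at_top_dense)
  define q where "q N = sqrt (2 * pi) * b N * exp ((b N)\<^sup>2 / 2) / real N" for N
  have q: "q \<longlonglongrightarrow> 1" unfolding q_def
    by (rule asymp_equivD_strong[OF b]) (rule eventually_mono[OF eventually_gt_at_top[of 0]], simp)
  have "(\<lambda>N. (ln (sqrt (2 * pi)) - ln (q N)) * (1 / (b N)\<^sup>2) + ln (b N) / (b N)\<^sup>2 + 1 / 2) \<longlonglongrightarrow>
      (ln (sqrt (2 * pi)) - ln 1) * 0 + 0 + 1 / 2"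
  proof (intro tendsto_intros q)
    have "((\<lambda>x::real. 1 / x\<^sup>2) \<longlongrightarrow> 0) at_top" "((\<lambda>x::real. ln x / x\<^sup>2) \<longlongrightarrow> 0) at_top" by real_asymp+
    then show "(\<lambda>N. 1 / (b N)\<^sup>2) \<longlonglongrightarrow> 0" "(\<lambda>N. ln (b N) / (b N)\<^sup>2) \<longlonglongrightarrow> 0"
      using filterlim_compose[OF _ top] by blast+
  qed simp
  moreover have "\<forall>\<^sub>F N in sequentially.
    (ln (sqrt (2 * pi)) - ln (q N)) * (1 / (b N)\<^sup>2) + ln (b N) / (b N)\<^sup>2 + 1 / 2 = ln (real N) / (b N)\<^sup>2"
    using pos eventually_gt_at_top[of 0]
  proof eventually_elim
    case (elim N)
    have "ln (q N) = ln (sqrt (2 * pi)) + ln (b N) + (b N)\<^sup>2 / 2 - ln (real N)"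
      unfolding q_def using elim by (subst ln_div) (auto simp: ln_mult_pos)
    then have "ln (real N) = (ln (sqrt (2 * pi)) - ln (q N)) + ln (b N) + (b N)\<^sup>2 / 2" by simp
    then have "ln (real N) / (b N)\<^sup>2 = (ln (sqrt (2 * pi)) - ln (q N)) / (b N)\<^sup>2 + ln (b N) / (b N)\<^sup>2 + (b N)\<^sup>2 / 2 / (b N)\<^sup>2"
      by (simp only: add_divide_distrib)
    then show ?case using elim by simp
  qed
  ultimately have "(\<lambda>N. ln (real N) / (b N)\<^sup>2) \<longlonglongrightarrow> 1 / 2"
    using Lim_transform_eventually by (force simp del: ln_sqrt)
  then have "(\<lambda>N. sqrt (inverse (ln (real N) / (b N)\<^sup>2))) \<longlonglongrightarrow> sqrt (inverse (1 / 2))"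
    by (rule tendsto_real_sqrt[OF tendsto_inverse]) simp
  moreover have "\<forall>\<^sub>F N in sequentially. sqrt (inverse (ln (real N) / (b N)\<^sup>2)) = b N / sqrt (ln (real N))"
    using pos by eventually_elim (simp add: real_sqrt_divide)
  ultimately show 1: "(\<lambda>N. b N / sqrt (ln (real N))) \<longlonglongrightarrow> sqrt 2"
    using Lim_transform_eventually by force
  have "(\<lambda>N. b N / sqrt (ln (real N)) * inverse (q N)) \<longlonglongrightarrow> sqrt 2 * inverse 1"
    by (intro tendsto_intros 1 q) simp
  moreover have "\<forall>\<^sub>F N in sequentially. b N / sqrt (ln (real N)) * inverse (q N) =
     real N / sqrt (ln (real N)) * std_normal_density (b N)"
    using pos eventually_gt_at_top[of 0]
    by eventually_elim (simp add: q_def std_normal_density_def exp_minus field_simps)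
  ultimately show "(\<lambda>N. real N / sqrt (ln (real N)) * std_normal_density (b N)) \<longlonglongrightarrow> sqrt 2"
    using Lim_transform_eventually by force
qed

lemma integrable_exp_neg_abs:
  fixes k :: real assumes k: "0 < k"
  shows "integrable lborel (\<lambda>y. exp (- (k * \<bar>y\<bar>)))"
proof -
  have pos: "integrable lborel (\<lambda>y. indicator {0<..} y *\<^sub>R exp (- (y * k)))"
    using integrable_I0i_exp_mscale[OF k] by (simp add: set_integrable_def)
  then have neg: "integrable lborel (\<lambda>y. indicator {0<..} (0 + (-1) * y) *\<^sub>R exp (- ((0 + (-1) * y) * k)))"
    by (rule lborel_integrable_real_affine) simp
  show ?thesis
  proof (rule Bochner_Integration.integrable_bound[OF Bochner_Integration.integrable_add[OF Bochner_Integration.integrable_add[OF pos neg]]])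
    show "integrable lborel (indicat_real {0})" by simp
    show "AE y in lborel. norm (exp (- (k * \<bar>y\<bar>))) \<le> norm (indicator {0<..} y *\<^sub>R exp (- (y * k)) +
       indicator {0<..} (0 + (-1) * y) *\<^sub>R exp (- ((0 + (-1) * y) * k)) + indicat_real {0} y)"
      by (intro AE_I2) (auto simp: indicator_def abs_if mult.commute)
  qed auto
qed

text \<open>The constant \<open>c\<close> in the characteristic function \<open>exp (- c \<bar>z\<bar> powr \<alpha>)\<close> of the limit: the exponent at \<open>\<bar>z\<bar> = 1\<close>.\<close>

definition stable_scale :: "real \<Rightarrow> real" where
  "stable_scale \<sigma> = (\<integral>y. sqrt 2 * exp (- (sqrt 2 * y)) * (1 - circle_mean (exp (\<sigma> * y))) \<partial>lborel)"

lemma two_sigma_gt_sqrt2: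
  assumes "1 / sqrt 2 < \<sigma>" shows "sqrt 2 < 2 * \<sigma>"
proof -
  have "2 * (1 / sqrt 2) < 2 * \<sigma>" using assms by (intro mult_strict_left_mono) auto
  then show ?thesis using real_div_sqrt[of 2] by simp
qed

lemma pos_of_gt_half_sqrt2:
  fixes \<sigma> :: real
  assumes "1 / sqrt 2 < \<sigma>" shows "0 < \<sigma>"
  using two_sigma_gt_sqrt2[OF assms] real_sqrt_gt_zero[of 2] by linarith

text \<open>Any rate below both \<open>sqrt 2\<close>, the decay of the intensity at \<open>+ \<infinity>\<close>, and \<open>2 \<sigma> - sqrt 2\<close>, the decay at \<open>- \<infinity>\<close> of the intensity times the
  squared modulus, would do. Halving leaves room for a perturbation of \<open>sqrt 2\<close> by the same amount.\<close>

definition decay_rate :: "real \<Rightarrow> real" where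
  "decay_rate \<sigma> = min (sqrt 2) (2 * \<sigma> - sqrt 2) / 2"

lemma decay_rate_pos: "1 / sqrt 2 < \<sigma> \<Longrightarrow> 0 < decay_rate \<sigma>"
  using two_sigma_gt_sqrt2[of \<sigma>] by (simp add: decay_rate_def)

lemma exponential_weight_decay:
  assumes "1 / sqrt 2 < \<sigma>" and \<beta>: "\<bar>\<beta> - sqrt 2\<bar> \<le> decay_rate \<sigma>"
  shows "exp (- (\<beta> * y)) * min 1 (exp (2 * \<sigma> * y)) \<le> exp (- (decay_rate \<sigma> * \<bar>y\<bar>))"
proof -
  let ?d = "decay_rate \<sigma>"
  have d: "2 * ?d \<le> sqrt 2" "2 * ?d \<le> 2 * \<sigma> - sqrt 2" by (auto simp: decay_rate_def)
  show ?thesis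
  proof (cases "0 \<le> y")
    case True
    have "?d \<le> \<beta>" using \<beta> d by linarith
    then have "?d * y \<le> \<beta> * y" using True by (rule mult_right_mono)
    then have "exp (- (\<beta> * y)) * 1 \<le> exp (- (?d * \<bar>y\<bar>))" using True by simp
    then show ?thesis by (meson exp_ge_zero min.cobounded1 mult_left_mono order_trans)
  next
    case False
    have "?d \<le> 2 * \<sigma> - \<beta>" using \<beta> d by linarith
    then have "(2 * \<sigma> - \<beta>) * y \<le> ?d * y" using False by (intro mult_right_mono_neg) auto
    then have "exp (- (\<beta> * y)) * exp (2 * \<sigma> * y) \<le> exp (- (?d * \<bar>y\<bar>))"
      using False by (simp add: exp_add[symmetric] algebra_simps)
    then show ?thesis by (meson exp_ge_zero min.cobounded2 mult_left_mono order_trans)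
  qed
qed

lemma circle_mean_measurable[measurable]: "circle_mean \<in> borel_measurable borel"
proof -
  interpret U: real_distribution circle_angle by (rule circle_angle_distribution)
  have "circle_mean = (\<lambda>R. \<integral>\<theta>. cos (R * cos \<theta>) \<partial>circle_angle)" by (auto simp: circle_mean_def)
  also have "\<dots> \<in> borel_measurable borel" by measurable
  finally show ?thesis .
qed

lemma stable_scale_integrable:
  assumes \<sigma>: "1 / sqrt 2 < \<sigma>"
  shows "integrable lborel (\<lambda>y. sqrt 2 * exp (- (sqrt 2 * y)) * (1 - circle_mean (exp (\<sigma> * y))))"
proof (rule Bochner_Integration.integrable_bound)
  show "integrable lborel (\<lambda>y. 2 * sqrt 2 * exp (- (decay_rate \<sigma> * \<bar>y\<bar>)))"
    by (intro integrable_mult_right integrable_exp_neg_abs decay_rate_pos \<sigma>)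
  show "AE y in lborel. norm (sqrt 2 * exp (- (sqrt 2 * y)) * (1 - circle_mean (exp (\<sigma> * y))))
      \<le> norm (2 * sqrt 2 * exp (- (decay_rate \<sigma> * \<bar>y\<bar>)))"
  proof (rule AE_I2)
    fix y
    have "1 - circle_mean (exp (\<sigma> * y)) \<le> 2 * min 1 (exp (2 * \<sigma> * y))"
    proof (cases "1 \<le> exp (2 * \<sigma> * y)")
      case True
      then show ?thesis using circle_mean_bounds(2)[of "exp (\<sigma> * y)"] by simp
    next
      case False
      have "1 - circle_mean (exp (\<sigma> * y)) \<le> exp (2 * \<sigma> * y) / 2"
        using circle_mean_bounds(3)[of "exp (\<sigma> * y)"] by (simp add: exp_double[symmetric] mult.assoc)
      also have "\<dots> \<le> 2 * exp (2 * \<sigma> * y)" by simp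
      finally show ?thesis using False by simp
    qed
    then have "sqrt 2 * exp (- (sqrt 2 * y)) * (1 - circle_mean (exp (\<sigma> * y)))
        \<le> sqrt 2 * exp (- (sqrt 2 * y)) * (2 * min 1 (exp (2 * \<sigma> * y)))"
      by (intro mult_left_mono) auto
    also have "\<dots> = 2 * sqrt 2 * (exp (- (sqrt 2 * y)) * min 1 (exp (2 * \<sigma> * y)))" by simp
    also have "\<dots> \<le> 2 * sqrt 2 * exp (- (decay_rate \<sigma> * \<bar>y\<bar>))"
      using decay_rate_pos[OF \<sigma>] by (intro mult_left_mono exponential_weight_decay \<sigma>) auto
    finally show "norm (sqrt 2 * exp (- (sqrt 2 * y)) * (1 - circle_mean (exp (\<sigma> * y))))
      \<le> norm (2 * sqrt 2 * exp (- (decay_rate \<sigma> * \<bar>y\<bar>)))"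
      using circle_mean_bounds(1)[of "exp (\<sigma> * y)"] by (simp add: abs_mult)
  qed
qed measurable

lemma stable_scale_pos:
  assumes \<sigma>: "1 / sqrt 2 < \<sigma>"
  shows "0 < stable_scale \<sigma>"
proof -
  let ?f = "\<lambda>y. sqrt 2 * exp (- (sqrt 2 * y)) * (1 - circle_mean (exp (\<sigma> * y)))"
  have nonneg: "0 \<le> ?f y" for y using circle_mean_bounds(1) by (intro mult_nonneg_nonneg) auto
  have \<sigma>0: "0 < \<sigma>" by (rule pos_of_gt_half_sqrt2[OF \<sigma>])
  have "stable_scale \<sigma> \<noteq> 0"
  proof
    assume "stable_scale \<sigma> = 0"
    then have "AE y in lborel. ?f y = 0"
      using integral_nonneg_eq_0_iff_AE[OF stable_scale_integrable[OF \<sigma>]] nonneg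
      by (auto simp: stable_scale_def)
    then have "AE y in lborel. y \<notin> {- 1 .. 0 :: real}"
    proof eventually_elim
      case (elim y)
      then have "circle_mean (exp (\<sigma> * y)) = 1" by simp
      then show ?case
        using circle_mean_less_1[of "exp (\<sigma> * y)"] \<sigma>0
        by (auto simp: mult_nonneg_nonpos)
    qed
    moreover have "{y \<in> space lborel. \<not> y \<notin> {- 1 .. 0 :: real}} = {- 1 .. 0}" by auto
    ultimately have "emeasure lborel {- 1 .. 0 :: real} = 0"
      by (subst (asm) AE_iff_measurable) auto
    then show False by simp
  qed
  moreover have "0 \<le> stable_scale \<sigma>" unfolding stable_scale_def using nonneg by (intro integral_nonneg_AE) auto
  ultimately show ?thesis by simp
qed

text \<open>The translation \<open>y \<mapsto> y - ln a / \<sigma>\<close> absorbs the factor \<open>a\<close>, and the exponential weight turns it into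
  \<open>a powr (sqrt 2 / \<sigma>)\<close>.\<close>

lemma stable_scale_homogeneous:
  assumes \<sigma>: "1 / sqrt 2 < \<sigma>" and a: "0 \<le> a"
  shows "(\<integral>y. sqrt 2 * exp (- (sqrt 2 * y)) * (1 - circle_mean (a * exp (\<sigma> * y))) \<partial>lborel)
    = stable_scale \<sigma> * a powr (sqrt 2 / \<sigma>)"
proof (cases "a = 0")
  case True
  have "circle_mean 0 = 1" using circle_mean_bounds(1,3)[of 0] by simp
  then show ?thesis using True by simp
next
  case False
  then have a: "0 < a" using a by simp
  have \<sigma>0: "0 < \<sigma>" by (rule pos_of_gt_half_sqrt2[OF \<sigma>])
  define t where "t = - (ln a / \<sigma>)"
  have 1: "a * exp (\<sigma> * (t + 1 * y)) = exp (\<sigma> * y)" for y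
  proof -
    have "\<sigma> * (t + 1 * y) = \<sigma> * y - ln a" using \<sigma>0 by (simp add: t_def field_simps)
    then show ?thesis using a by (simp add: exp_diff)
  qed
  have 2: "exp (- (sqrt 2 * (t + 1 * y))) = a powr (sqrt 2 / \<sigma>) * exp (- (sqrt 2 * y))" for y
    using a by (simp add: t_def powr_def exp_add[symmetric] algebra_simps)
  have "(\<integral>y. sqrt 2 * exp (- (sqrt 2 * y)) * (1 - circle_mean (a * exp (\<sigma> * y))) \<partial>lborel) =
     (\<integral>y. a powr (sqrt 2 / \<sigma>) * (sqrt 2 * exp (- (sqrt 2 * y)) * (1 - circle_mean (exp (\<sigma> * y)))) \<partial>lborel)"
    by (subst lborel_integral_real_affine[where c=1 and t=t]) (simp_all only: 1 2, simp_all add: mult_ac)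
  then show ?thesis by (simp add: stable_scale_def mult.commute)
qed

section \<open>The bivariate Gaussian law in independent coordinates\<close>

interpretation gauss: real_distribution gauss by (rule real_dist_normal_dist)
interpretation gauss2: pair_prob_space gauss gauss ..

text \<open>Regression of the second coordinate on the first, in terms of an independent residual \<open>\<xi>\<close>.\<close>

definition correlate :: "real \<Rightarrow> real \<times> real \<Rightarrow> real \<times> real" where
  "correlate \<rho> = (\<lambda>(x, \<xi>). (x, \<rho> * x + sqrt (1 - \<rho>\<^sup>2) * \<xi>))"

lemma correlate_measurable[measurable]: "correlate \<rho> \<in> borel_measurable (borel \<Otimes>\<^sub>M borel)"
  unfolding correlate_def by measurable

text \<open>Completing the square in the second coordinate; the factor on the left is the Jacobian of the regression map.\<close>

lemma bivariate_normal_density_factor: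
  assumes \<rho>: "\<bar>\<rho>\<bar> < 1"
  shows "sqrt (1 - \<rho>\<^sup>2) * bivariate_normal_density \<rho> (correlate \<rho> (x, \<xi>)) = std_normal_density x * std_normal_density \<xi>"
proof -
  define r where "r = sqrt (1 - \<rho>\<^sup>2)"
  have "\<rho>\<^sup>2 < 1" using \<rho> by (simp add: abs_square_less_1)
  then have r: "0 < r" "r\<^sup>2 = 1 - \<rho>\<^sup>2" by (auto simp: r_def)
  have "x\<^sup>2 - 2 * \<rho> * x * (\<rho> * x + r * \<xi>) + (\<rho> * x + r * \<xi>)\<^sup>2 = (1 - \<rho>\<^sup>2) * x\<^sup>2 + r\<^sup>2 * \<xi>\<^sup>2"
    by (simp add: power2_eq_square algebra_simps)
  also have "\<dots> = (1 - \<rho>\<^sup>2) * (x\<^sup>2 + \<xi>\<^sup>2)" by (simp only: r(2) distrib_left)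
  finally have "- (x\<^sup>2 - 2 * \<rho> * x * (\<rho> * x + r * \<xi>) + (\<rho> * x + r * \<xi>)\<^sup>2) / (2 * (1 - \<rho>\<^sup>2)) = - x\<^sup>2 / 2 + - \<xi>\<^sup>2 / 2"
    using \<open>\<rho>\<^sup>2 < 1\<close> by (simp add: field_simps)
  then have "bivariate_normal_density \<rho> (correlate \<rho> (x, \<xi>)) = 1 / (2 * pi * r) * (exp (- x\<^sup>2 / 2) * exp (- \<xi>\<^sup>2 / 2))"
    unfolding bivariate_normal_density_def correlate_def r_def[symmetric] by (simp add: exp_add[symmetric])
  moreover have sq: "sqrt (2 * pi) * sqrt (2 * pi) = 2 * pi" by simp
  have "std_normal_density x * std_normal_density \<xi> = 1 / (2 * pi) * (exp (- x\<^sup>2 / 2) * exp (- \<xi>\<^sup>2 / 2))"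
  proof -
    have factor: "1 / q * u * (1 / q * v) = 1 / (q * q) * (u * v)" for q u v :: real by simp
    show ?thesis unfolding std_normal_density_def factor sq ..
  qed
  ultimately show ?thesis using r(1) by (simp add: r_def[symmetric])
qed

lemma bivariate_normal_law:
  assumes D: "distributed M lborel Z (\<lambda>p. ennreal (bivariate_normal_density \<rho> p))" and \<rho>: "\<bar>\<rho>\<bar> < 1"
  shows "distr M borel Z = distr (gauss \<Otimes>\<^sub>M gauss) borel (correlate \<rho>)"
proof -
  define r where "r = sqrt (1 - \<rho>\<^sup>2)"
  have r: "0 < r" using \<rho> by (simp add: r_def abs_square_less_1)
  let ?f = "\<lambda>p. ennreal (bivariate_normal_density \<rho> p)"
  have [measurable]: "bivariate_normal_density \<rho> \<in> borel_measurable borel"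
    unfolding bivariate_normal_density_def borel_prod[symmetric] by measurable
  have "distr M borel Z = density lborel ?f"
    using distributed_distr_eq_density[OF D] by (simp cong: distr_cong)
  also have "\<dots> = distr (gauss \<Otimes>\<^sub>M gauss) borel (correlate \<rho>)"
  proof (rule measure_eqI)
    fix A :: "(real \<times> real) set" assume "A \<in> sets (density lborel ?f)"
    then have A[measurable]: "A \<in> sets borel" by simp
    have [measurable]: "A \<in> sets (borel \<Otimes>\<^sub>M borel)" "bivariate_normal_density \<rho> \<in> borel_measurable (borel \<Otimes>\<^sub>M borel)"
      unfolding borel_prod by (rule A, measurable)
    have "emeasure (density lborel ?f) A = (\<integral>\<^sup>+p. ?f p * indicator A p \<partial>(lborel \<Otimes>\<^sub>M lborel))"
      by (subst emeasure_density) (auto simp: lborel_prod)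
    also have "\<dots> = (\<integral>\<^sup>+x. \<integral>\<^sup>+y. ?f (x, y) * indicator A (x, y) \<partial>lborel \<partial>lborel)"
      by (rule lborel.nn_integral_fst[symmetric]) measurable
    also have "\<dots> = (\<integral>\<^sup>+x. \<integral>\<^sup>+\<xi>. ennreal (std_normal_density x) * (ennreal (std_normal_density \<xi>) * indicator A (correlate \<rho> (x, \<xi>))) \<partial>lborel \<partial>lborel)"
    proof (rule nn_integral_cong)
      fix x :: real
      have "(\<integral>\<^sup>+y. ?f (x, y) * indicator A (x, y) \<partial>lborel) =
        ennreal \<bar>r\<bar> * (\<integral>\<^sup>+\<xi>. ?f (x, \<rho> * x + r * \<xi>) * indicator A (x, \<rho> * x + r * \<xi>) \<partial>lborel)"
        using r by (intro nn_integral_real_affine) (auto simp: borel_prod[symmetric])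
      also have "\<dots> = (\<integral>\<^sup>+\<xi>. ennreal (r * bivariate_normal_density \<rho> (correlate \<rho> (x, \<xi>))) * indicator A (correlate \<rho> (x, \<xi>)) \<partial>lborel)"
        using r by (subst nn_integral_cmult[symmetric])
           (auto simp: borel_prod[symmetric] correlate_def r_def[symmetric] ennreal_mult' mult.assoc)
      also have "\<dots> = (\<integral>\<^sup>+\<xi>. ennreal (std_normal_density x) * (ennreal (std_normal_density \<xi>) * indicator A (correlate \<rho> (x, \<xi>))) \<partial>lborel)"
        unfolding r_def bivariate_normal_density_factor[OF \<rho>] by (simp add: ennreal_mult mult.assoc)
      finally show "(\<integral>\<^sup>+y. ?f (x, y) * indicator A (x, y) \<partial>lborel) = \<dots>" .
    qed
    also have "\<dots> = (\<integral>\<^sup>+x. \<integral>\<^sup>+\<xi>. indicator A (correlate \<rho> (x, \<xi>)) \<partial>gauss \<partial>gauss)"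
      by (subst nn_integral_density, simp, simp, subst nn_integral_density) (auto simp: nn_integral_cmult)
    also have "\<dots> = (\<integral>\<^sup>+p. indicator A (correlate \<rho> p) \<partial>(gauss \<Otimes>\<^sub>M gauss))"
      by (subst gauss.nn_integral_fst[symmetric]) auto
    also have "\<dots> = emeasure (distr (gauss \<Otimes>\<^sub>M gauss) borel (correlate \<rho>)) A"
      by (subst nn_integral_indicator[symmetric], simp, subst nn_integral_distr) auto
    finally show "emeasure (density lborel ?f) A = emeasure (distr (gauss \<Otimes>\<^sub>M gauss) borel (correlate \<rho>)) A" .
  qed simp
  finally show ?thesis .
qed

text \<open>The variable \<open>y\<close> is the position relative to the level \<open>b\<close> on the scale \<open>1 / s\<close>.\<close>

lemma gauss_integral_zoom:
  fixes f :: "real \<Rightarrow> 'b::{banach, second_countable_topology}"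
  assumes [measurable]: "f \<in> borel_measurable borel" and s: "0 < s"
  shows "a *\<^sub>R (\<integral>x. f x \<partial>gauss) = (\<integral>y. (a / s * std_normal_density (b + y / s)) *\<^sub>R f (b + y / s) \<partial>lborel)"
proof -
  have "(\<integral>x. f x \<partial>gauss) = (\<integral>x. std_normal_density x *\<^sub>R f x \<partial>lborel)"
    by (subst integral_density) auto
  also have "\<dots> = \<bar>1 / s\<bar> *\<^sub>R (\<integral>y. std_normal_density (b + 1 / s * y) *\<^sub>R f (b + 1 / s * y) \<partial>lborel)"
    using s by (intro lborel_integral_real_affine) auto
  finally show ?thesis
    using s by (simp add: integral_scaleR_right[symmetric] del: integral_scaleR_right)
qed

section \<open>Fluctuations of a sum of Gaussian exponentials\<close>

text \<open>One choice of the parameters and of the normalising sequence. The underlying probability space is introduced only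
  where independence is used, because the estimates concern the law of a single pair.\<close>

locale gaussian_exponentials =
  fixes \<sigma> \<tau> \<rho> :: real and b :: "nat \<Rightarrow> real"
  assumes \<sigma>: "1 / sqrt 2 < \<sigma>" and \<tau>: "\<tau> \<noteq> 0" and \<rho>: "\<bar>\<rho>\<bar> < 1"
    and b: "(\<lambda>N. sqrt (2 * pi) * b N * exp ((b N)\<^sup>2 / 2)) \<sim>[sequentially] (\<lambda>N. real N)"
begin

lemma \<sigma>_pos: "0 < \<sigma>" by (rule pos_of_gt_half_sqrt2[OF \<sigma>])

definition rootlog :: "nat \<Rightarrow> real" where "rootlog N = sqrt (ln (real N))"
definition resid :: real where "resid = sqrt (1 - \<rho>\<^sup>2)"

text \<open>\<open>window_density N\<close> is the density of \<open>N P(rootlog N (X - b N) \<in> dy)\<close>, that is, of the intensity of the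
  sample points around the level \<open>b N\<close> seen on the scale \<open>1 / rootlog N\<close>.\<close>

definition window_density :: "nat \<Rightarrow> real \<Rightarrow> real" where "window_density N y = real N / rootlog N * std_normal_density (b N + y / rootlog N)"

lemma resid_pos: "0 < resid" using \<rho> by (simp add: resid_def abs_square_less_1)

lemma rootlog_nonneg: "0 \<le> rootlog N"
  by (cases "N = 0") (auto simp: rootlog_def)

lemma rootlog_top: "filterlim rootlog at_top sequentially"
  unfolding rootlog_def by real_asymp

lemma rootlog_pos: "\<forall>\<^sub>F N in sequentially. 0 < rootlog N"
  using rootlog_top by (simp add: filterlim_at_top_dense)

lemma window_density_measurable[measurable]: "window_density N \<in> borel_measurable borel"
  unfolding window_density_def by measurable

lemma window_density_nonneg: "0 \<le> window_density N y"
  unfolding window_density_def using rootlog_nonneg by (intro mult_nonneg_nonneg divide_nonneg_nonneg) auto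

lemma window_density_factor:
  assumes "0 < rootlog N"
  shows "window_density N y = (real N / rootlog N * std_normal_density (b N)) * exp (- (b N / rootlog N * y)) * exp (- (y\<^sup>2 / 2 * (1 / rootlog N)\<^sup>2))"
proof -
  have "- (b N + y / rootlog N)\<^sup>2 / 2 = - (b N)\<^sup>2 / 2 + - (b N / rootlog N * y) + - (y\<^sup>2 / 2 * (1 / rootlog N)\<^sup>2)"
    using assms by (simp add: power2_eq_square field_simps)
  then show ?thesis
    unfolding window_density_def std_normal_density_def by (simp only: exp_add)
qed

lemma window_density_tendsto: "(\<lambda>N. window_density N y) \<longlonglongrightarrow> sqrt 2 * exp (- (sqrt 2 * y))"
proof -
  have "(\<lambda>N. 1 / rootlog N) \<longlonglongrightarrow> 0" using rootlog_top by (intro tendsto_divide_0[OF tendsto_const]) (simp add: filterlim_at_top_imp_at_infinity)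
  then have "(\<lambda>N. (real N / rootlog N * std_normal_density (b N)) * exp (- (b N / rootlog N * y)) * exp (- (y\<^sup>2 / 2 * (1 / rootlog N)\<^sup>2)))
    \<longlonglongrightarrow> sqrt 2 * exp (- (sqrt 2 * y)) * exp (- (y\<^sup>2 / 2 * 0\<^sup>2))"
    unfolding rootlog_def
    by (intro tendsto_intros normalising_sequence_asymptotics[OF b])
  then have "(\<lambda>N. (real N / rootlog N * std_normal_density (b N)) * exp (- (b N / rootlog N * y)) * exp (- (y\<^sup>2 / 2 * (1 / rootlog N)\<^sup>2)))
    \<longlonglongrightarrow> sqrt 2 * exp (- (sqrt 2 * y))" by simp
  then show ?thesis
    by (rule Lim_transform_eventually) (use rootlog_pos in eventually_elim, simp add: window_density_factor)
qed

text \<open>The Gaussian factor of the density is at most 1, and the exponential one is compared with \<open>exp (- sqrt 2 y)\<close> at the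
  cost of \<open>decay_rate \<sigma>\<close>. The weight \<open>min 1 (exp (2 \<sigma> y))\<close> is what the integrands below admit.\<close>

lemma window_density_bound:
  "\<forall>\<^sub>F N in sequentially. \<forall>y. window_density N y * min 1 (exp (2 * \<sigma> * y)) \<le> 2 * exp (- (decay_rate \<sigma> * \<bar>y\<bar>))"
proof -
  have "\<forall>\<^sub>F N in sequentially. real N / rootlog N * std_normal_density (b N) < 2"
    using normalising_sequence_asymptotics(2)[OF b] unfolding rootlog_def
    by (rule order_tendstoD) (use sqrt2_less_2 in simp)
  moreover have "\<forall>\<^sub>F N in sequentially. dist (b N / rootlog N) (sqrt 2) < decay_rate \<sigma>"
    using normalising_sequence_asymptotics(1)[OF b] unfolding rootlog_def
    by (rule tendstoD) (rule decay_rate_pos[OF \<sigma>])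
  ultimately show ?thesis using rootlog_pos
  proof eventually_elim
    case (elim N)
    show ?case
    proof
      fix y
      have "window_density N y * min 1 (exp (2 * \<sigma> * y)) =
        (real N / rootlog N * std_normal_density (b N)) * (exp (- (b N / rootlog N * y)) * min 1 (exp (2 * \<sigma> * y))) * exp (- (y\<^sup>2 / 2 * (1 / rootlog N)\<^sup>2))"
        by (simp add: window_density_factor[OF elim(3)])
      also have "\<dots> \<le> 2 * exp (- (decay_rate \<sigma> * \<bar>y\<bar>)) * 1"
        using elim by (intro mult_mono exponential_weight_decay \<sigma>) (auto simp: dist_real_def intro!: mult_nonneg_nonneg)
      finally show "window_density N y * min 1 (exp (2 * \<sigma> * y)) \<le> 2 * exp (- (decay_rate \<sigma> * \<bar>y\<bar>))" by simp
    qed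
  qed
qed

lemma window_density_integral_tendsto:
  fixes G :: "nat \<Rightarrow> real \<Rightarrow> 'b::{banach, second_countable_topology}"
  assumes [measurable]: "\<And>N. G N \<in> borel_measurable borel" "G' \<in> borel_measurable borel"
    and lim: "\<And>y. (\<lambda>N. G N y) \<longlonglongrightarrow> G' y"
    and bd: "\<And>N y. norm (G N y) \<le> C * min 1 (exp (2 * \<sigma> * y))"
  shows "(\<lambda>N. \<integral>y. window_density N y *\<^sub>R G N y \<partial>lborel) \<longlonglongrightarrow> (\<integral>y. (sqrt 2 * exp (- (sqrt 2 * y))) *\<^sub>R G' y \<partial>lborel)"
proof -
  have "norm (G 0 0) \<le> C" using bd[of 0 0] by simp
  then have C: "0 \<le> C" using norm_ge_zero order_trans by blast
  \<comment> \<open>The domination holds from some index on, so the sequence is shifted by \<open>N0\<close>.\<close>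
  obtain N0 where N0: "\<And>N y. N0 \<le> N \<Longrightarrow> window_density N y * min 1 (exp (2 * \<sigma> * y)) \<le> 2 * exp (- (decay_rate \<sigma> * \<bar>y\<bar>))"
    using window_density_bound by (auto simp: eventually_sequentially)
  have "(\<lambda>N. \<integral>y. window_density (N + N0) y *\<^sub>R G (N + N0) y \<partial>lborel) \<longlonglongrightarrow> (\<integral>y. (sqrt 2 * exp (- (sqrt 2 * y))) *\<^sub>R G' y \<partial>lborel)"
  proof (rule integral_dominated_convergence[where w="\<lambda>y. C * 2 * exp (- (decay_rate \<sigma> * \<bar>y\<bar>))"])
    show "integrable lborel (\<lambda>y. C * 2 * exp (- (decay_rate \<sigma> * \<bar>y\<bar>)))"
      by (intro integrable_mult_right integrable_exp_neg_abs decay_rate_pos \<sigma>)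
    show "AE y in lborel. (\<lambda>N. window_density (N + N0) y *\<^sub>R G (N + N0) y) \<longlonglongrightarrow> (sqrt 2 * exp (- (sqrt 2 * y))) *\<^sub>R G' y"
      by (intro AE_I2 tendsto_scaleR LIMSEQ_ignore_initial_segment window_density_tendsto lim)
    fix N
    show "AE y in lborel. norm (window_density (N + N0) y *\<^sub>R G (N + N0) y) \<le> C * 2 * exp (- (decay_rate \<sigma> * \<bar>y\<bar>))"
    proof (rule AE_I2)
      fix y
      have "norm (window_density (N + N0) y *\<^sub>R G (N + N0) y) \<le> window_density (N + N0) y * (C * min 1 (exp (2 * \<sigma> * y)))"
        using window_density_nonneg[of "N + N0" y] bd[of "N + N0" y] by (simp add: mult_left_mono)
      also have "\<dots> \<le> C * (2 * exp (- (decay_rate \<sigma> * \<bar>y\<bar>)))"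
        using mult_left_mono[OF N0[of "N + N0" y] C] by (simp add: mult_ac)
      finally show "norm (window_density (N + N0) y *\<^sub>R G (N + N0) y) \<le> C * 2 * exp (- (decay_rate \<sigma> * \<bar>y\<bar>))" by simp
    qed
  qed measurable
  then show ?thesis by (rule LIMSEQ_offset)
qed

definition summand :: "nat \<Rightarrow> real \<times> real \<Rightarrow> complex" where
  "summand N p = of_real (exp (\<sigma> * rootlog N * (fst p - b N))) * iexp (\<tau> * rootlog N * snd p)"

definition pair_law :: "(real \<times> real) measure" where
  "pair_law = distr (gauss \<Otimes>\<^sub>M gauss) borel (correlate \<rho>)"

lemma summand_measurable[measurable]: "summand N \<in> borel_measurable borel"
  unfolding summand_def borel_prod[symmetric] by measurable

definition tmean :: "nat \<Rightarrow> complex" where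
  "tmean N = (\<integral>p. summand N p * indicator {..<b N} (fst p) \<partial>pair_law)"

lemma pair_law_prob: "prob_space pair_law"
  unfolding pair_law_def by (rule gauss2.prob_space_distr) simp

lemma pair_law_sets[measurable_cong]: "sets pair_law = sets borel"
  by (simp add: pair_law_def)

lemma pair_law_integral:
  fixes f :: "real \<times> real \<Rightarrow> complex"
  assumes [measurable]: "f \<in> borel_measurable borel" and bd: "\<And>p. norm (f p) \<le> B"
  shows "(\<integral>p. f p \<partial>pair_law) = (\<integral>x. (\<integral>\<xi>. f (x, \<rho> * x + resid * \<xi>) \<partial>gauss) \<partial>gauss)"
proof -
  have "(\<integral>p. f p \<partial>pair_law) = (\<integral>p. f (correlate \<rho> p) \<partial>(gauss \<Otimes>\<^sub>M gauss))"
    unfolding pair_law_def by (subst integral_distr) auto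
  also have "\<dots> = (\<integral>x. (\<integral>\<xi>. f (correlate \<rho> (x, \<xi>)) \<partial>gauss) \<partial>gauss)"
    by (rule gauss2.integral_fst'[symmetric], rule gauss2.integrable_const_bound[of _ B]) (use bd in auto)
  finally show ?thesis by (simp add: correlate_def resid_def)
qed

lemma truncated_summand_measurable[measurable]:
  "(\<lambda>p. summand N p * indicator {..<b N} (fst p)) \<in> borel_measurable borel"
  unfolding borel_prod[symmetric] summand_def by measurable

lemma truncated_summand_bound: "norm (summand N p * indicator {..<b N} (fst p)) \<le> 1"
  using \<sigma>_pos rootlog_nonneg[of N]
  by (auto simp: summand_def norm_mult indicator_def mult_nonneg_nonpos simp del: of_real_mult)

lemma phase_variance_top: "filterlim (\<lambda>N. (\<tau> * rootlog N * resid)\<^sup>2) at_top sequentially"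
proof -
  have "filterlim (\<lambda>N. (\<tau> * resid)\<^sup>2 * (rootlog N * rootlog N)) at_top sequentially"
    using \<tau> resid_pos by (intro filterlim_tendsto_pos_mult_at_top[OF tendsto_const] filterlim_at_top_mult_at_top rootlog_top) auto
  then show ?thesis by (simp add: power2_eq_square mult_ac)
qed

text \<open>Given \<open>X\<close>, averaging the phase yields a factor of modulus \<open>exp (- (\<tau> * rootlog N * resid)\<^sup>2 / 2)\<close>, the same for all \<open>X\<close>; the moduli are handled by Jensen's
  inequality.\<close>

lemma truncated_mean_bound:
  "(cmod (tmean N))\<^sup>2 \<le> exp (- (\<tau> * rootlog N * resid)\<^sup>2) * (\<integral>x. exp (2 * \<sigma> * (rootlog N * (x - b N))) * indicator {..<b N} x \<partial>gauss)"
proof -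
  define f where "f x = exp (\<sigma> * rootlog N * (x - b N)) * indicator {..<b N} x" for x
  define e where "e = exp (- ((1 * (\<tau> * rootlog N * resid))\<^sup>2 / 2))"
  have f: "0 \<le> f x" "f x \<le> 1" for x
    using \<sigma>_pos rootlog_nonneg[of N] by (auto simp: f_def indicator_def mult_nonneg_nonpos)
  have [measurable]: "f \<in> borel_measurable borel" unfolding f_def by measurable
  have f_int: "integrable gauss f" by (rule gauss.integrable_const_bound[of _ 1]) (use f in auto)
  have f2_int: "integrable gauss (\<lambda>x. (f x)\<^sup>2)"
    by (rule gauss.integrable_const_bound[of _ 1]) (use f in \<open>auto simp: power_le_one\<close>)
  have "tmean N = (\<integral>x. (\<integral>\<xi>. of_real (f x) * iexp (1 * (\<tau> * rootlog N * \<rho> * x + \<tau> * rootlog N * resid * \<xi>)) \<partial>gauss) \<partial>gauss)"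
    unfolding tmean_def
    by (subst pair_law_integral[OF truncated_summand_measurable truncated_summand_bound])
       (auto intro!: Bochner_Integration.integral_cong simp: summand_def f_def indicator_def algebra_simps)
  also have "\<dots> = (\<integral>x. of_real (f x) * (iexp (1 * (\<tau> * rootlog N * \<rho> * x)) * of_real e) \<partial>gauss)"
    unfolding integral_mult_right_zero gauss_phase_char e_def ..
  finally have "cmod (tmean N) \<le> (\<integral>x. cmod (of_real (f x) * (iexp (1 * (\<tau> * rootlog N * \<rho> * x)) * of_real e)) \<partial>gauss)"
    by (simp only: integral_norm_bound)
  also have "\<dots> = (\<integral>x. f x * e \<partial>gauss)"
    using f(1) by (intro Bochner_Integration.integral_cong) (auto simp: norm_mult e_def simp del: of_real_mult)
  also have "\<dots> = e * (\<integral>x. f x \<partial>gauss)" by (simp add: mult.commute)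
  finally have "(cmod (tmean N))\<^sup>2 \<le> (e * (\<integral>x. f x \<partial>gauss))\<^sup>2" by (intro power_mono) auto
  also have "\<dots> = e\<^sup>2 * (\<integral>x. f x \<partial>gauss)\<^sup>2" by (simp add: power_mult_distrib)
  also have "(\<integral>x. f x \<partial>gauss)\<^sup>2 \<le> (\<integral>x. (f x)\<^sup>2 \<partial>gauss)"
    using gauss.variance_eq[OF f_int f2_int] gauss.variance_positive[of f] by linarith
  also have "(\<integral>x. (f x)\<^sup>2 \<partial>gauss) = (\<integral>x. exp (2 * \<sigma> * (rootlog N * (x - b N))) * indicator {..<b N} x \<partial>gauss)"
    by (intro Bochner_Integration.integral_cong) (auto simp: f_def indicator_def exp_double[symmetric] mult.assoc)
  also have "e\<^sup>2 = exp (- (\<tau> * rootlog N * resid)\<^sup>2)" by (simp add: e_def exp_double[symmetric])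
  finally show ?thesis by (simp add: mult_left_mono)
qed

text \<open>The truncated second moment times \<open>N\<close> converges, and the average of the phase tends to zero. This is where the
  hypothesis on \<open>\<tau>\<close> enters for the centring.\<close>

lemma N_truncated_mean_sq_tendsto: "(\<lambda>N. real N * (cmod (tmean N))\<^sup>2) \<longlonglongrightarrow> 0"
proof -
  let ?I = "\<lambda>N. \<integral>x. exp (2 * \<sigma> * (rootlog N * (x - b N))) * indicator {..<b N} x \<partial>gauss"
  let ?g = "\<lambda>y::real. exp (2 * \<sigma> * y) * indicator {..<0} y"
  obtain l where "(\<lambda>N. \<integral>y. window_density N y *\<^sub>R ?g y \<partial>lborel) \<longlonglongrightarrow> l"
  proof -
    have "norm (?g y) \<le> 1 * min 1 (exp (2 * \<sigma> * y))" for y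
      using \<sigma>_pos by (auto simp: indicator_def mult_nonneg_nonpos)
    then show ?thesis using that window_density_integral_tendsto[of "\<lambda>_. ?g" ?g 1] by simp
  qed
  moreover have "\<forall>\<^sub>F N in sequentially. (\<integral>y. window_density N y *\<^sub>R ?g y \<partial>lborel) = real N * ?I N"
    using rootlog_pos
  proof eventually_elim
    case (elim N)
    have "real N *\<^sub>R ?I N = (\<integral>y. window_density N y *\<^sub>R (exp (2 * \<sigma> * (rootlog N * (b N + y / rootlog N - b N))) * indicator {..<b N} (b N + y / rootlog N)) \<partial>lborel)"
      unfolding window_density_def by (rule gauss_integral_zoom[OF _ elim]) measurable
    also have "\<dots> = (\<integral>y. window_density N y *\<^sub>R ?g y \<partial>lborel)"
      using elim by (intro Bochner_Integration.integral_cong) (auto simp: indicator_def divide_less_0_iff)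
    finally show ?case by simp
  qed
  ultimately have "(\<lambda>N. real N * ?I N) \<longlonglongrightarrow> l" by (rule Lim_transform_eventually)
  moreover have "(\<lambda>N. exp (- (\<tau> * rootlog N * resid)\<^sup>2)) \<longlonglongrightarrow> 0"
    by (intro filterlim_compose[OF exp_at_bot] filterlim_compose[OF filterlim_uminus_at_bot_at_top] phase_variance_top)
  ultimately have "(\<lambda>N. exp (- (\<tau> * rootlog N * resid)\<^sup>2) * (real N * ?I N)) \<longlonglongrightarrow> 0 * l" by (intro tendsto_intros)
  then have lim: "(\<lambda>N. exp (- (\<tau> * rootlog N * resid)\<^sup>2) * (real N * ?I N)) \<longlonglongrightarrow> 0" by simp
  show ?thesis
  proof (rule tendsto_sandwich[OF _ _ tendsto_const lim])
    show "\<forall>\<^sub>F N in sequentially. real N * (cmod (tmean N))\<^sup>2 \<le> exp (- (\<tau> * rootlog N * resid)\<^sup>2) * (real N * ?I N)"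
      using mult_left_mono[OF truncated_mean_bound] by (intro always_eventually allI) (simp add: mult.left_commute)
  qed auto
qed

text \<open>The truncated linear term is the one that centring by \<open>tmean N\<close> removes.\<close>

definition excess :: "nat \<Rightarrow> complex \<Rightarrow> real \<times> real \<Rightarrow> complex" where
  "excess N z p = iexp (Re (summand N p * cnj z)) - 1 - \<i> * of_real (Re (summand N p * indicator {..<b N} (fst p) * cnj z))"

lemma Re_summand_polar:
  "Re (summand N (x, y) * cnj z) = cmod z * exp (\<sigma> * rootlog N * (x - b N)) * cos (\<tau> * rootlog N * y - Arg z)"
proof -
  have "cnj z = of_real (cmod z) * cis (- Arg z)"
    using rcis_cmod_Arg[of z] by (metis cis_cnj complex_cnj_complex_of_real complex_cnj_mult rcis_def)
  then have "summand N (x, y) * cnj z = of_real (exp (\<sigma> * rootlog N * (x - b N)) * cmod z) * cis (\<tau> * rootlog N * y - Arg z)"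
    by (simp add: summand_def cis_conv_exp[symmetric] cis_mult[symmetric] diff_conv_add_uminus del: of_real_mult add_uminus_conv_diff)
       (simp only: of_real_mult)
  then show ?thesis by (simp add: mult.commute)
qed

lemma excess_polar:
  "excess N z (x, y) = polar_excess (cmod z * exp (\<sigma> * rootlog N * (x - b N))) (x < b N) (\<tau> * rootlog N * y - Arg z)"
  unfolding excess_def polar_excess_def by (simp only: Re_summand_polar fst_conv) (simp add: Re_summand_polar[symmetric] indicator_def)

text \<open>The conditional expectation of \<open>excess N z\<close> given that \<open>X\<close> is at position \<open>y\<close> in the window.\<close>

definition phase_mean :: "nat \<Rightarrow> complex \<Rightarrow> real \<Rightarrow> complex" where
  "phase_mean N z y = (\<integral>\<xi>. polar_excess (cmod z * exp (\<sigma> * y)) (y < 0)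
     ((\<tau> * rootlog N * \<rho> * (b N + y / rootlog N) - Arg z) + \<tau> * rootlog N * resid * \<xi>) \<partial>gauss)"

lemma phase_mean_measurable[measurable]: "phase_mean N z \<in> borel_measurable borel"
  unfolding phase_mean_def by measurable

lemma excess_measurable[measurable]: "excess N z \<in> borel_measurable borel"
proof -
  have "excess N z = (\<lambda>(x, y). polar_excess (cmod z * exp (\<sigma> * rootlog N * (x - b N))) (x < b N) (\<tau> * rootlog N * y - Arg z))"
    by (auto simp: excess_polar)
  also have "\<dots> \<in> borel_measurable borel" unfolding borel_prod[symmetric] by measurable
  finally show ?thesis .
qed

lemma excess_bound: "cmod (excess N z p) \<le> 2 + (cmod z)\<^sup>2"
proof (cases p)
  case (Pair x y)
  show ?thesis
  proof (cases "x < b N")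
    case True
    have "exp (\<sigma> * rootlog N * (x - b N)) \<le> 1"
      using True \<sigma>_pos rootlog_nonneg[of N] by (simp add: mult_nonneg_nonpos)
    then have "(cmod z * exp (\<sigma> * rootlog N * (x - b N)))\<^sup>2 \<le> (cmod z * 1)\<^sup>2"
      by (intro power_mono mult_left_mono) auto
    then show ?thesis
      using polar_excess_bound(1)[of "cmod z * exp (\<sigma> * rootlog N * (x - b N))" "\<tau> * rootlog N * y - Arg z"]
        zero_le_power2[of "cmod z"]
      unfolding Pair excess_polar eqTrueI[OF True] mult_1_right by linarith
  next
    case False
    then show ?thesis
      using polar_excess_bound(2)[of "cmod z * exp (\<sigma> * rootlog N * (x - b N))" "\<tau> * rootlog N * y - Arg z"]
      unfolding Pair excess_polar by (simp add: add_increasing2)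
  qed
qed

lemma phase_mean_bound: "cmod (phase_mean N z y) \<le> (2 + (cmod z)\<^sup>2) * min 1 (exp (2 * \<sigma> * y))"
proof -
  let ?R = "cmod z * exp (\<sigma> * y)"
  let ?C = "(2 + (cmod z)\<^sup>2) * min 1 (exp (2 * \<sigma> * y))"
  have bd: "cmod (polar_excess ?R (y < 0) \<theta>) \<le> ?C" for \<theta>
  proof (cases "y < 0")
    case True
    have "exp (2 * \<sigma> * y) \<le> 1" using True \<sigma>_pos by (simp add: mult_nonneg_nonpos)
    then have "?C = (2 + (cmod z)\<^sup>2) * exp (2 * \<sigma> * y)" by simp
    moreover have "?R\<^sup>2 / 2 = (cmod z)\<^sup>2 / 2 * exp (2 * \<sigma> * y)"
      by (simp add: power_mult_distrib exp_double[symmetric] mult.assoc)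
    moreover have "(cmod z)\<^sup>2 / 2 * exp (2 * \<sigma> * y) \<le> (2 + (cmod z)\<^sup>2) * exp (2 * \<sigma> * y)"
      by (intro mult_right_mono) auto
    ultimately show ?thesis using polar_excess_bound(1)[of ?R \<theta>] unfolding eqTrueI[OF True] by linarith
  next
    case False
    then have "1 \<le> exp (2 * \<sigma> * y)" using \<sigma>_pos by simp
    then show ?thesis using polar_excess_bound(2)[of ?R \<theta>] False by (simp add: add_increasing2)
  qed
  have "cmod (phase_mean N z y) \<le> (\<integral>\<xi>. cmod (polar_excess ?R (y < 0)
     ((\<tau> * rootlog N * \<rho> * (b N + y / rootlog N) - Arg z) + \<tau> * rootlog N * resid * \<xi>)) \<partial>gauss)"
    unfolding phase_mean_def by (rule integral_norm_bound)
  also have "\<dots> \<le> ?C"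
    by (intro gauss.integral_le_const gauss.integrable_const_bound[of _ ?C]) (use bd in auto)
  finally show ?thesis .
qed

lemma phase_mean_tendsto: "(\<lambda>N. phase_mean N z y) \<longlonglongrightarrow> of_real (circle_mean (cmod z * exp (\<sigma> * y)) - 1)"
proof -
  define R where "R = cmod z * exp (\<sigma> * y)"
  define \<mu> where "\<mu> N = \<tau> * rootlog N * \<rho> * (b N + y / rootlog N) - Arg z" for N
  define v where "v N = \<tau> * rootlog N * resid" for N
  have v: "filterlim (\<lambda>N. (v N)\<^sup>2) at_top sequentially" unfolding v_def by (rule phase_variance_top)
  have int1: "integrable gauss (\<lambda>\<xi>. iexp (R * cos (\<mu> N + v N * \<xi>)))" for N
    by (rule gauss.integrable_const_bound[of _ 1]) (auto simp del: of_real_mult)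
  have int2: "integrable gauss (\<lambda>\<xi>. iexp (1 * (\<mu> N + v N * \<xi>)))" for N
    by (rule gauss.integrable_const_bound[of _ 1]) (auto simp del: of_real_mult)
  have int3: "integrable gauss (\<lambda>\<xi>. of_real (if y < 0 then R * cos (\<mu> N + v N * \<xi>) else 0) :: complex)" for N
    by (rule gauss.integrable_const_bound[of _ "\<bar>R\<bar>"]) (auto simp: abs_mult mult_left_le)
  have linear: "(\<integral>\<xi>. of_real (if y < 0 then R * cos (\<mu> N + v N * \<xi>) else 0) \<partial>gauss) =
    (if y < 0 then complex_of_real (R * Re (\<integral>\<xi>. iexp (1 * (\<mu> N + v N * \<xi>)) \<partial>gauss)) else 0)" for N
  proof (cases "y < 0")
    case True
    have "Re (\<integral>\<xi>. iexp (1 * (\<mu> N + v N * \<xi>)) \<partial>gauss) = (\<integral>\<xi>. cos (\<mu> N + v N * \<xi>) \<partial>gauss)"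
      by (subst integral_Re[OF int2, symmetric]) (simp add: Re_exp)
    then show ?thesis using True
      by (simp only: if_True integral_complex_of_real integral_mult_right_zero)
  qed simp
  have "phase_mean N z y = (\<integral>\<xi>. iexp (R * cos (\<mu> N + v N * \<xi>)) \<partial>gauss) - 1 -
      \<i> * (if y < 0 then complex_of_real (R * Re (\<integral>\<xi>. iexp (1 * (\<mu> N + v N * \<xi>)) \<partial>gauss)) else 0)" for N
    unfolding phase_mean_def polar_excess_def R_def[symmetric] \<mu>_def[symmetric] v_def[symmetric] linear[symmetric]
    by (subst Bochner_Integration.integral_diff)
       (use int1[of N] int3[of N] gauss.prob_space in \<open>simp_all del: of_real_mult\<close>)
  moreover have "(\<lambda>N. if y < 0 then complex_of_real (R * Re (\<integral>\<xi>. iexp (1 * (\<mu> N + v N * \<xi>)) \<partial>gauss)) else 0)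
      \<longlonglongrightarrow> (if y < 0 then complex_of_real (R * Re 0) else 0)"
  proof (cases "y < 0")
    case True
    then show ?thesis
      by (simp only: if_True)
         (intro tendsto_of_real tendsto_mult tendsto_const tendsto_Re wide_gauss_phase_char_tendsto_0 v zero_neq_one[symmetric])
  qed simp
  then have "(\<lambda>N. (\<integral>\<xi>. iexp (R * cos (\<mu> N + v N * \<xi>)) \<partial>gauss) - 1 -
      \<i> * (if y < 0 then complex_of_real (R * Re (\<integral>\<xi>. iexp (1 * (\<mu> N + v N * \<xi>)) \<partial>gauss)) else 0))
      \<longlonglongrightarrow> of_real (circle_mean R) - 1 - \<i> * (if y < 0 then complex_of_real (R * Re 0) else 0)"
    by (intro tendsto_diff tendsto_mult tendsto_const wide_gauss_phase_wave_tendsto v)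
  moreover have "(if y < 0 then complex_of_real (R * Re 0) else 0) = 0" by simp
  ultimately show ?thesis by (simp only: mult_zero_right diff_0_right of_real_diff of_real_1 R_def)
qed

text \<open>After integrating out the residual and zooming in on the level \<open>b N\<close>, the left-hand side is the integral of \<open>phase_mean N z\<close>
  against the window density, and dominated convergence applies.\<close>

lemma N_excess_tendsto:
  "(\<lambda>N. of_nat N * (\<integral>p. excess N z p \<partial>pair_law))
     \<longlonglongrightarrow> of_real (- stable_scale \<sigma> * cmod z powr (sqrt 2 / \<sigma>))"
proof -
  have "(\<lambda>N. \<integral>y. window_density N y *\<^sub>R phase_mean N z y \<partial>lborel) \<longlonglongrightarrow>
     (\<integral>y. (sqrt 2 * exp (- (sqrt 2 * y))) *\<^sub>R complex_of_real (circle_mean (cmod z * exp (\<sigma> * y)) - 1) \<partial>lborel)"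
    by (rule window_density_integral_tendsto[OF _ _ phase_mean_tendsto phase_mean_bound]) measurable
  also have "(\<lambda>y. (sqrt 2 * exp (- (sqrt 2 * y))) *\<^sub>R complex_of_real (circle_mean (cmod z * exp (\<sigma> * y)) - 1)) =
    (\<lambda>y. complex_of_real (- (sqrt 2 * exp (- (sqrt 2 * y)) * (1 - circle_mean (cmod z * exp (\<sigma> * y))))))"
    by (auto simp: scaleR_conv_of_real algebra_simps)
  also have "(\<integral>y. \<dots> y \<partial>lborel) = of_real (- stable_scale \<sigma> * cmod z powr (sqrt 2 / \<sigma>))"
    unfolding integral_complex_of_real Bochner_Integration.integral_minus
    by (subst stable_scale_homogeneous[OF \<sigma>]) auto
  finally have lim: "(\<lambda>N. \<integral>y. window_density N y *\<^sub>R phase_mean N z y \<partial>lborel) \<longlonglongrightarrow> of_real (- stable_scale \<sigma> * cmod z powr (sqrt 2 / \<sigma>))" .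
  have "\<forall>\<^sub>F N in sequentially. (\<integral>y. window_density N y *\<^sub>R phase_mean N z y \<partial>lborel) = of_nat N * (\<integral>p. excess N z p \<partial>pair_law)"
    using rootlog_pos
  proof eventually_elim
    case (elim N)
    define F where "F x = (\<integral>\<xi>. excess N z (x, \<rho> * x + resid * \<xi>) \<partial>gauss)" for x
    have [measurable]: "F \<in> borel_measurable borel" unfolding F_def borel_prod[symmetric] excess_polar by measurable
    have "of_nat N * (\<integral>p. excess N z p \<partial>pair_law) = real N *\<^sub>R (\<integral>x. F x \<partial>gauss)"
      unfolding F_def by (subst pair_law_integral[OF _ excess_bound]) (auto simp: scaleR_conv_of_real)
    also have "\<dots> = (\<integral>y. window_density N y *\<^sub>R F (b N + y / rootlog N) \<partial>lborel)"
      unfolding window_density_def by (rule gauss_integral_zoom[OF _ elim]) measurable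
    also have "\<dots> = (\<integral>y. window_density N y *\<^sub>R phase_mean N z y \<partial>lborel)"
      unfolding F_def phase_mean_def excess_polar using elim
      by (intro Bochner_Integration.integral_cong) (simp_all add: divide_less_0_iff algebra_simps)
    finally show ?case by simp
  qed
  with lim show ?thesis by (rule Lim_transform_eventually)
qed

definition summand_cf :: "nat \<Rightarrow> complex \<Rightarrow> complex" where
  "summand_cf N z = (\<integral>p. iexp (Re ((summand N p - tmean N) * cnj z)) \<partial>pair_law)"

lemma summand_cf_eq:
  defines "t \<equiv> \<lambda>N z. Re (tmean N * cnj z)"
  shows "summand_cf N z = iexp (- t N z) * (1 + \<i> * of_real (t N z) + (\<integral>p. excess N z p \<partial>pair_law))"
proof -
  interpret P: prob_space pair_law by (rule pair_law_prob)
  have int1: "integrable pair_law (\<lambda>p. summand N p * indicator {..<b N} (fst p))"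
    by (rule P.integrable_const_bound[of _ 1]) (use truncated_summand_bound in simp, measurable)
  have int2: "integrable pair_law (excess N z)"
    by (rule P.integrable_const_bound[of _ "2 + (cmod z)\<^sup>2"]) (use excess_bound in auto)
  have int1': "integrable pair_law (\<lambda>p. complex_of_real (Re (summand N p * indicator {..<b N} (fst p) * cnj z)))"
    using int1 by (intro integrable_of_real integrable_Re integrable_mult_left)
  then have int_i: "integrable pair_law (\<lambda>p. \<i> * complex_of_real (Re (summand N p * indicator {..<b N} (fst p) * cnj z)))"
    by (rule integrable_mult_right)
  have t: "(\<integral>p. complex_of_real (Re (summand N p * indicator {..<b N} (fst p) * cnj z)) \<partial>pair_law) = of_real (t N z)"
    unfolding t_def tmean_def integral_complex_of_real
    using int1 by (subst integral_Re) (auto simp del: times_complex.sel)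
  have "iexp (Re ((summand N p - tmean N) * cnj z)) =
     iexp (- t N z) * (1 + \<i> * of_real (Re (summand N p * indicator {..<b N} (fst p) * cnj z)) + excess N z p)" for p
  proof -
    have "Re ((summand N p - tmean N) * cnj z) = - t N z + Re (summand N p * cnj z)"
      by (simp add: t_def left_diff_distrib del: times_complex.sel)
    then have "iexp (Re ((summand N p - tmean N) * cnj z)) = iexp (- t N z) * iexp (Re (summand N p * cnj z))"
      by (simp only: of_real_add distrib_left exp_add)
    moreover have "1 + \<i> * u + (v - 1 - \<i> * u) = v" for u v :: complex by simp
    ultimately show ?thesis by (simp only: excess_def)
  qed
  then have "summand_cf N z = iexp (- t N z) * (\<integral>p. 1 + \<i> * of_real (Re (summand N p * indicator {..<b N} (fst p) * cnj z)) + excess N z p \<partial>pair_law)"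
    unfolding summand_cf_def by (simp only: integral_mult_right_zero)
  also have "(\<integral>p. 1 + \<i> * of_real (Re (summand N p * indicator {..<b N} (fst p) * cnj z)) + excess N z p \<partial>pair_law) =
    1 + \<i> * of_real (t N z) + (\<integral>p. excess N z p \<partial>pair_law)"
    unfolding Bochner_Integration.integral_add[OF Bochner_Integration.integrable_add[OF P.integrable_const int_i] int2]
      Bochner_Integration.integral_add[OF P.integrable_const int_i] integral_mult_right_zero t
    by (simp add: P.prob_space)
  finally show ?thesis .
qed

lemma summand_cf_le_1: "cmod (summand_cf N z) \<le> 1"
proof -
  interpret P: prob_space pair_law by (rule pair_law_prob)
  have "cmod (summand_cf N z) \<le> (\<integral>p. cmod (iexp (Re ((summand N p - tmean N) * cnj z))) \<partial>pair_law)"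
    unfolding summand_cf_def by (rule integral_norm_bound)
  also have "\<dots> = 1" by (simp add: P.prob_space del: times_complex.sel)
  finally show ?thesis .
qed

text \<open>With \<open>t = Re (tmean N * cnj z)\<close>, centring multiplies \<open>1 + \<i> t + E (excess)\<close> by \<open>iexp (- t)\<close>. The error
  \<open>iexp (- t) (1 + \<i> t) - 1\<close> is of order \<open>t\<^sup>2\<close>, which is negligible against \<open>1 / N\<close>.\<close>

lemma N_summand_cf_tendsto:
  "(\<lambda>N. of_nat N * (summand_cf N z - 1)) \<longlonglongrightarrow> of_real (- stable_scale \<sigma> * cmod z powr (sqrt 2 / \<sigma>))"
proof -
  define t where "t N = Re (tmean N * cnj z)" for N
  define J where "J N = of_nat N * (\<integral>p. excess N z p \<partial>pair_law)" for N
  have Nt: "(\<lambda>N. real N * (t N)\<^sup>2) \<longlonglongrightarrow> 0"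
  proof (rule tendsto_sandwich[OF _ _ tendsto_const])
    have "(\<lambda>N. real N * (cmod (tmean N))\<^sup>2 * (cmod z)\<^sup>2) \<longlonglongrightarrow> 0 * (cmod z)\<^sup>2"
      by (intro tendsto_intros N_truncated_mean_sq_tendsto)
    then show "(\<lambda>N. real N * (cmod (tmean N))\<^sup>2 * (cmod z)\<^sup>2) \<longlonglongrightarrow> 0" by simp
    show "\<forall>\<^sub>F N in sequentially. real N * (t N)\<^sup>2 \<le> real N * (cmod (tmean N))\<^sup>2 * (cmod z)\<^sup>2"
    proof (intro always_eventually allI)
      fix N
      have "\<bar>t N\<bar> \<le> cmod (tmean N) * cmod z"
        unfolding t_def using abs_Re_le_cmod[of "tmean N * cnj z"] by (simp add: norm_mult)
      then have "(t N)\<^sup>2 \<le> (cmod (tmean N) * cmod z)\<^sup>2" by (metis abs_ge_zero power2_abs power_mono)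
      then show "real N * (t N)\<^sup>2 \<le> real N * (cmod (tmean N))\<^sup>2 * (cmod z)\<^sup>2"
        by (simp add: power_mult_distrib mult.assoc mult_left_mono)
    qed
  qed auto
  have t2: "(\<lambda>N. (t N)\<^sup>2) \<longlonglongrightarrow> 0"
  proof (rule tendsto_sandwich[OF _ _ tendsto_const Nt])
    show "\<forall>\<^sub>F N in sequentially. (t N)\<^sup>2 \<le> real N * (t N)\<^sup>2"
      using eventually_ge_at_top[of 1] by eventually_elim (simp add: mult_le_cancel_right1)
  qed auto
  have "(\<lambda>N. \<bar>t N\<bar>) \<longlonglongrightarrow> 0"
    using tendsto_real_sqrt[OF t2] by simp
  then have t0: "t \<longlonglongrightarrow> 0" by (rule tendsto_rabs_zero_cancel)
  have "(\<lambda>N. of_nat N * (1 + \<i> * of_real (t N) - iexp (t N))) \<longlonglongrightarrow> 0"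
  proof (rule Lim_null_comparison)
    show "\<forall>\<^sub>F N in sequentially. norm (of_nat N * (1 + \<i> * of_real (t N) - iexp (t N))) \<le> real N * (t N)\<^sup>2"
    proof (intro always_eventually allI)
      fix N
      have "cmod (1 + \<i> * of_real (t N) - iexp (t N)) = cmod (iexp (t N) - 1 - \<i> * of_real (t N))"
        by (subst norm_minus_commute) (simp add: algebra_simps)
      also have "\<dots> \<le> (t N)\<^sup>2 / 2" by (rule iexp_taylor1)
      also have "\<dots> \<le> (t N)\<^sup>2" by simp
      finally show "norm (of_nat N * (1 + \<i> * of_real (t N) - iexp (t N))) \<le> real N * (t N)\<^sup>2"
        by (simp add: norm_mult mult_left_mono)
    qed
  qed (rule Nt)
  then have "(\<lambda>N. iexp (- t N) * (J N + of_nat N * (1 + \<i> * of_real (t N) - iexp (t N))))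
      \<longlonglongrightarrow> iexp (- 0) * (of_real (- stable_scale \<sigma> * cmod z powr (sqrt 2 / \<sigma>)) + 0)"
    unfolding J_def by (intro tendsto_intros t0 N_excess_tendsto)
  moreover have "iexp (- t N) * (J N + of_nat N * (1 + \<i> * of_real (t N) - iexp (t N))) = of_nat N * (summand_cf N z - 1)" for N
  proof -
    have "iexp (- t N) * iexp (t N) = 1" by (simp add: exp_add[symmetric])
    then have "of_nat N * (summand_cf N z - 1) = of_nat N * (summand_cf N z - iexp (- t N) * iexp (t N))" by simp
    then show ?thesis unfolding summand_cf_eq t_def[symmetric] J_def by (simp add: algebra_simps)
  qed
  ultimately show ?thesis by simp
qed

theorem summand_cf_power_tendsto:
  "(\<lambda>N. summand_cf N z ^ N) \<longlonglongrightarrow> of_real (exp (- stable_scale \<sigma> * cmod z powr (sqrt 2 / \<sigma>)))"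
proof -
  have "(\<lambda>N. summand_cf N z ^ N) \<longlonglongrightarrow> exp (complex_of_real (- stable_scale \<sigma> * cmod z powr (sqrt 2 / \<sigma>)))"
    using stable_scale_pos[OF \<sigma>]
    by (intro power_tendsto_exp summand_cf_le_1 N_summand_cf_tendsto) auto
  then show ?thesis by (simp only: exp_of_real)
qed

lemma normalised_fluctuation_eq:
  assumes iid: "iid_gaussian_pairs M \<rho> X Y"
  shows "(partition_function X Y (\<sigma>, \<tau>) N \<omega> - of_nat N * truncated_mean M (X 0) (Y 0) (\<sigma>, \<tau>) b N)
           / complex_of_real (exp (\<sigma> * sqrt (ln (real N)) * b N))
         = (\<Sum>k=1..N. summand N (X k \<omega>, Y k \<omega>) - tmean N)"
proof -
  let ?a = "complex_of_real (exp (\<sigma> * rootlog N * b N))"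
  have term_eq: "exp (complex_of_real (sqrt (ln (real N))) * (complex_of_real (\<sigma> * x) + \<i> * complex_of_real (\<tau> * y))) = ?a * summand N (x, y)" for x y
    unfolding summand_def rootlog_def exp_of_real[symmetric] exp_add[symmetric] by (simp add: algebra_simps)
  have D0: "distributed M lborel (\<lambda>\<omega>. (X 0 \<omega>, Y 0 \<omega>)) (\<lambda>p. ennreal (bivariate_normal_density \<rho> p))"
    using iid by (simp add: iid_gaussian_pairs_def)
  have meas: "(\<lambda>\<omega>. (X 0 \<omega>, Y 0 \<omega>)) \<in> borel_measurable M"
    using distributed_measurable[OF D0] by simp
  have "truncated_mean M (X 0) (Y 0) (\<sigma>, \<tau>) b N = (\<integral>\<omega>. ?a * (summand N (X 0 \<omega>, Y 0 \<omega>) * indicator {..<b N} (fst (X 0 \<omega>, Y 0 \<omega>))) \<partial>M)"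
    unfolding truncated_mean_def by (simp only: prod.case term_eq fst_conv mult.assoc)
  also have "\<dots> = ?a * (\<integral>p. summand N p * indicator {..<b N} (fst p) \<partial>distr M borel (\<lambda>\<omega>. (X 0 \<omega>, Y 0 \<omega>)))"
    unfolding integral_mult_right_zero by (subst integral_distr[OF meas truncated_summand_measurable]) simp
  also have "\<dots> = ?a * tmean N"
    unfolding bivariate_normal_law[OF D0 \<rho>] tmean_def pair_law_def ..
  finally have mean: "truncated_mean M (X 0) (Y 0) (\<sigma>, \<tau>) b N = ?a * tmean N" .
  have "partition_function X Y (\<sigma>, \<tau>) N \<omega> = ?a * (\<Sum>k=1..N. summand N (X k \<omega>, Y k \<omega>))"
    unfolding partition_function_def by (simp only: prod.case term_eq sum_distrib_left)
  then show ?thesis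
    unfolding mean rootlog_def[symmetric] by (simp add: sum_subtractf right_diff_distrib[symmetric] mult.left_commute[of _ ?a])
qed

lemma fluctuation_cf:
  assumes iid: "iid_gaussian_pairs M \<rho> X Y"
  shows "(\<integral>\<omega>. iexp (Re ((\<Sum>k=1..N. summand N (X k \<omega>, Y k \<omega>) - tmean N) * cnj z)) \<partial>M) = summand_cf N z ^ N"
proof -
  interpret prob_space M using iid by (simp add: iid_gaussian_pairs_def)
  define g where "g p = iexp (Re ((summand N p - tmean N) * cnj z))" for p
  have g_meas[measurable]: "g \<in> borel_measurable borel" unfolding g_def by measurable
  have D: "distributed M lborel (\<lambda>\<omega>. (X k \<omega>, Y k \<omega>)) (\<lambda>p. ennreal (bivariate_normal_density \<rho> p))" for k
    using iid by (simp add: iid_gaussian_pairs_def)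
  have meas[measurable]: "(\<lambda>\<omega>. (X k \<omega>, Y k \<omega>)) \<in> borel_measurable M" for k
    using distributed_measurable[OF D] by simp
  have "indep_vars (\<lambda>_. borel) (\<lambda>k \<omega>. (X k \<omega>, Y k \<omega>)) UNIV"
    using iid by (simp add: iid_gaussian_pairs_def)
  then have "indep_vars (\<lambda>_. borel) (\<lambda>k \<omega>. (X k \<omega>, Y k \<omega>)) {1..N}"
    by (rule indep_vars_subset) simp
  then have ind: "indep_vars (\<lambda>_. borel) (\<lambda>k \<omega>. g (X k \<omega>, Y k \<omega>)) {1..N}"
    by (rule indep_vars_compose2) simp
  have "iexp (Re ((\<Sum>k=1..N. summand N (X k \<omega>, Y k \<omega>) - tmean N) * cnj z)) = (\<Prod>k=1..N. g (X k \<omega>, Y k \<omega>))" for \<omega>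
    unfolding g_def exp_sum[OF finite_atLeastAtMost, symmetric]
    by (simp only: sum_distrib_right Re_sum of_real_sum sum_distrib_left)
  then have "(\<integral>\<omega>. iexp (Re ((\<Sum>k=1..N. summand N (X k \<omega>, Y k \<omega>) - tmean N) * cnj z)) \<partial>M) = (\<integral>\<omega>. (\<Prod>k=1..N. g (X k \<omega>, Y k \<omega>)) \<partial>M)"
    by (simp only:)
  also have "\<dots> = (\<Prod>k=1..N. \<integral>\<omega>. g (X k \<omega>, Y k \<omega>) \<partial>M)"
  proof (rule indep_vars_lebesgue_integral[OF _ ind])
    show "integrable M (\<lambda>\<omega>. g (X k \<omega>, Y k \<omega>))" for k
      by (rule integrable_const_bound[of _ 1]) (auto simp: g_def simp del: times_complex.sel)
  qed simp
  also have "\<dots> = (\<Prod>k=1..N. summand_cf N z)"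
  proof (rule prod.cong[OF refl])
    fix k
    have "(\<integral>\<omega>. g (X k \<omega>, Y k \<omega>) \<partial>M) = (\<integral>p. g p \<partial>distr M borel (\<lambda>\<omega>. (X k \<omega>, Y k \<omega>)))"
      by (subst integral_distr) auto
    then show "(\<integral>\<omega>. g (X k \<omega>, Y k \<omega>) \<partial>M) = summand_cf N z"
      unfolding bivariate_normal_law[OF D \<rho>] pair_law_def[symmetric] summand_cf_def g_def .
  qed
  finally show ?thesis by simp
qed

end

section \<open>The limit theorem\<close>

theorem theorem2p20:
  fixes \<sigma> :: real
  assumes "\<sigma> > 1 / sqrt 2"
  shows "\<exists>S :: complex measure. isotropic_stable_law (sqrt 2 / \<sigma>) S \<and>
    (\<forall>(\<tau> :: real) (\<rho> :: real) (M :: 'a measure) (X :: nat \<Rightarrow> 'a \<Rightarrow> real)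
       (Y :: nat \<Rightarrow> 'a \<Rightarrow> real) (b :: nat \<Rightarrow> real).
       \<tau> \<noteq> 0 \<longrightarrow> \<bar>\<rho>\<bar> < 1 \<longrightarrow> iid_gaussian_pairs M \<rho> X Y \<longrightarrow>
       (\<lambda>N. sqrt (2 * pi) * b N * exp ((b N)\<^sup>2 / 2)) \<sim>[sequentially] (\<lambda>N. real N) \<longrightarrow>
       converges_in_distribution M
         (\<lambda>N \<omega>. (partition_function X Y (\<sigma>, \<tau>) N \<omega>
                   - of_nat N * truncated_mean M (X 0) (Y 0) (\<sigma>, \<tau>) b N)
                 / complex_of_real (exp (\<sigma> * sqrt (ln (real N)) * b N)))
         S)"
proof -
  have \<sigma>0: "0 < \<sigma>" by (rule pos_of_gt_half_sqrt2[OF assms])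
  have \<alpha>: "0 < sqrt 2 / \<sigma>" "sqrt 2 / \<sigma> < 2"
    using \<sigma>0 two_sigma_gt_sqrt2[OF assms] by (auto simp: field_simps)
  obtain S where S: "prob_space S" "sets S = sets (borel :: complex measure)" and
    cf_S: "\<And>z. (\<integral>w. iexp (Re (w * cnj z)) \<partial>S) = of_real (exp (- stable_scale \<sigma> * cmod z powr (sqrt 2 / \<sigma>)))"
    using isotropic_stable_law_exists[OF \<alpha> stable_scale_pos[OF assms]] by blast
  have "isotropic_stable_law (sqrt 2 / \<sigma>) S"
    unfolding isotropic_stable_law_def using S cf_S stable_scale_pos[OF assms] by blast
  moreover have "converges_in_distribution M
         (\<lambda>N \<omega>. (partition_function X Y (\<sigma>, \<tau>) N \<omega>
                   - of_nat N * truncated_mean M (X 0) (Y 0) (\<sigma>, \<tau>) b N)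
                 / complex_of_real (exp (\<sigma> * sqrt (ln (real N)) * b N))) S"
    if "\<tau> \<noteq> 0" "\<bar>\<rho>\<bar> < 1" and iid: "iid_gaussian_pairs M \<rho> X Y"
      and "(\<lambda>N. sqrt (2 * pi) * b N * exp ((b N)\<^sup>2 / 2)) \<sim>[sequentially] (\<lambda>N. real N)"
    for \<tau> \<rho> :: real and M :: "'a measure" and X Y :: "nat \<Rightarrow> 'a \<Rightarrow> real" and b :: "nat \<Rightarrow> real"
  proof -
    interpret gaussian_exponentials \<sigma> \<tau> \<rho> b by unfold_locales fact+
    have [measurable]: "(\<lambda>\<omega>. (X k \<omega>, Y k \<omega>)) \<in> borel_measurable M" for k
      using iid distributed_measurable[of M lborel "\<lambda>\<omega>. (X k \<omega>, Y k \<omega>)"] by (auto simp: iid_gaussian_pairs_def)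
    show ?thesis
      unfolding normalised_fluctuation_eq[OF iid]
    proof (rule complex_levy_continuity[OF _ _ S])
      show "prob_space M" using iid by (simp add: iid_gaussian_pairs_def)
      show "(\<lambda>\<omega>. \<Sum>k=1..N. summand N (X k \<omega>, Y k \<omega>) - tmean N) \<in> borel_measurable M" for N
        by measurable
      show "(\<lambda>N. \<integral>\<omega>. iexp (Re ((\<Sum>k=1..N. summand N (X k \<omega>, Y k \<omega>) - tmean N) * cnj z)) \<partial>M)
          \<longlonglongrightarrow> (\<integral>w. iexp (Re (w * cnj z)) \<partial>S)" for z
        unfolding fluctuation_cf[OF iid] cf_S by (rule summand_cf_power_tendsto)
    qed
  qed
  ultimately show ?thesis by blast
qed

end
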